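(* For every $j\in\alpha_N$, consider the actual platoon vehicle $\dot x_j=A_jx_j+B_ww_{j-1}+B_u\theta_ju_{ad,j}$ and the reference platoon vehicle $\dot x_{r,j}=A_mx_{r,j}+B_ww_{j-1}$ described in the context. The control input $u_{ad,j}=\hat k_{x,j}^Tx_j$ and the adaptive update law $\dot{\hat k}_{x,j}=-\Gamma_{x,j}\psi'(\|\tilde x_j\|_{P_m})x_j\tilde x_j^TP_mB_u$, where $\tilde x_j=x_j-x_{r,j}$, ensure the following: 1) The origin of the error dynamics of $(\tilde x_j,\tilde k_{x,j})$, $$\dot{\tilde x}_j=A_m\tilde x_j+B_u\theta_j\tilde k_{x,j}^Tx_j,\qquad \dot{\tilde k}_{x,j}=-\Gamma_{x,j}\psi'(\|\tilde x_j\|_{P_m})x_j\tilde x_j^TP_mB_u,$$ is Lyapunov stable, for all $j\in\alpha_N$. 2) The state tracking error is guaranteed to satisfy $\|\tilde x_j(t)\|_{P_m}<c$ for all $t\ge0$ and all $j\in\alpha_N$.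
   Context: $N\ge1$, $\alpha_N=\{1,\dots,N\}$. Constants $h,k_p,k_d,\bar\tau>0$ with $k_d>\bar\tau k_p$; $c>0$ is a user-chosen constant; $\tau_j>0$, $\Lambda_j>0$ are unknown constants, $\theta_j=\Lambda_j/\tau_j$. $\|\eta\|_M=\sqrt{\eta^TM\eta}$. Barrier function: $\psi(r)=\frac{r^2}{c-r}$ for $0\le r<c$, and $\psi'(r)=\frac{d\psi}{d(r^2)}=\frac{2c-r}{2(c-r)^2}$. $$A_m=\begin{bmatrix}0&-1&-h&0\\0&0&1&0\\0&0&-1/\bar\tau&1/\bar\tau\\k_p/h&-k_d/h&-k_d&-1/h\end{bmatrix},\quad A_j=\begin{bmatrix}0&-1&-h&0\\0&0&1&0\\0&0&-1/\tau_j&\Lambda_j/\tau_j\\k_p/h&-k_d/h&-k_d&-1/h\end{bmatrix},\quad B_w=\begin{bmatrix}1&0\\0&0\\0&0\\k_d/h&1/h\end{bmatrix},\quad B_u=\begin{bmatrix}0\\0\\1\\0\end{bmatrix}.$$ $x_j=(e_j,v_j,a_j,u_{bl,j})^T$ (spacing error, velocity, acceleration, baseline control), $x_{r,j}\in\mathbb R^4$ is the reference state, and $w_{j-1}=(v_{j-1},u_{bl,j-1})^T$ is the signal from the preceding actual vehicle (index $0$ being the leader). $\hat k_{x,j}(t)\in\mathbb R^4$ is the adaptive gain and $\tilde k_{x,j}=\hat k_{x,j}-k_{x,j}$, where $k_{x,j}^T=\left[0\ \ 0\ \ \frac{\bar\tau-\tau_j}{\Lambda_j\bar\tau}\ \ \frac{\tau_j-\Lambda_j\bar\tau}{\Lambda_j\bar\tau}\right]$,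 which satisfies $A_m=A_j+B_u\theta_jk_{x,j}^T$. $\Gamma_{x,j}$ is a symmetric positive definite adaptation gain matrix; $P_m=P_m^T>0$ satisfies $A_m^TP_m+P_mA_m=-Q_m$ for a chosen $Q_m=Q_m^T>0$. In the error dynamics, $x_j=\tilde x_j+x_{r,j}(t)$. *)

theory Defs
  imports "HOL-Analysis.Analysis"
begin

subsection \<open>Ordinary differential equations and Lyapunov stability\<close>

text \<open>
  Derivatives are taken within the time set \<open>I\<close>, hence one-sided at an initial time.
\<close>

definition ode_sol :: "(real \<Rightarrow> 'a \<Rightarrow> 'a) \<Rightarrow> real set \<Rightarrow> (real \<Rightarrow> 'a::real_normed_vector) \<Rightarrow> bool" where
  "ode_sol f I y \<longleftrightarrow> (\<forall>t\<in>I. (y has_vector_derivative f t (y t)) (at t within I))"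

definition forward_interval :: "real \<Rightarrow> real set \<Rightarrow> bool" where
  "forward_interval t0 I \<longleftrightarrow> is_interval I \<and> t0 \<in> I \<and> I \<subseteq> {t0..}"

text \<open>
  Stability of the origin of a time-varying system \<open>y' = f t y\<close>, \<open>t \<ge> 0\<close>.  Solutions are not
  assumed to live for all time: the last conjunct speaks about solutions on arbitrary intervals
  starting at \<open>t0\<close>, and the one before it says that there is a solution without finite escape
  time.  As usual for time-varying systems, \<open>\<delta>\<close> may depend on \<open>t0\<close>.
\<close>

definition lyapunov_stable_origin :: "(real \<Rightarrow> 'a \<Rightarrow> 'a::real_normed_vector) \<Rightarrow> bool" where
  "lyapunov_stable_origin f \<longleftrightarrow>
     (\<forall>t\<ge>0. f t 0 = 0) \<and>
     (\<forall>t0\<ge>0. \<forall>\<epsilon>>0. \<exists>\<delta>>0. \<forall>y0. norm y0 < \<delta> \<longrightarrow>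
        (\<exists>y. ode_sol f {t0..} y \<and> y t0 = y0) \<and>
        (\<forall>I y. forward_interval t0 I \<and> ode_sol f I y \<and> y t0 = y0 \<longrightarrow>
               (\<forall>t\<in>I. norm (y t) < \<epsilon>)))"

subsection \<open>Weighted norms and the barrier function\<close>

definition sym_pos_def :: "real^'n^'n \<Rightarrow> bool" where
  "sym_pos_def M \<longleftrightarrow> transpose M = M \<and> (\<forall>v. v \<noteq> 0 \<longrightarrow> v \<bullet> (M *v v) > 0)"

definition wnorm :: "real^'n^'n \<Rightarrow> real^'n \<Rightarrow> real" where
  "wnorm M \<eta> = sqrt (\<eta> \<bullet> (M *v \<eta>))"

definition psi :: "real \<Rightarrow> real \<Rightarrow> real" where
  "psi c r = r\<^sup>2 / (c - r)"

text \<open>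
  The derivative of the barrier function with respect to the \<^emph>\<open>square\<close> of its argument; both
  functions are meaningful for \<open>0 \<le> r < c\<close> only.
\<close>

definition psi' :: "real \<Rightarrow> real \<Rightarrow> real" where
  "psi' c r = (2 * c - r) / (2 * (c - r)\<^sup>2)"

lemma has_real_derivative_psi:
  assumes "0 < r" "r < c"
  shows "((\<lambda>s. psi c (sqrt s)) has_real_derivative psi' c r) (at (r\<^sup>2))"
proof -
  have ds: "(sqrt has_real_derivative 1 / (2 * r)) (at (r\<^sup>2))"
    using DERIV_real_sqrt[of "r\<^sup>2"] assms by (simp add: field_simps)
  have dp: "(psi c has_real_derivative (2 * r * (c - r) + r\<^sup>2) / (c - r)\<^sup>2) (at r)"
    unfolding psi_def using assms
    by (auto intro!: derivative_eq_intros simp: power2_eq_square)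
  have "(2 * r * (c - r) + r\<^sup>2) / (c - r)\<^sup>2 * (1 / (2 * r)) = psi' c r"
    using assms by (simp add: psi'_def divide_simps) (simp add: power2_eq_square algebra_simps)
  then show ?thesis
    using DERIV_chain2[of "psi c" _ sqrt "r\<^sup>2", OF _ ds] dp assms by fastforce
qed

subsection \<open>The platoon\<close>

text \<open>
  Arguments: time headway, the two baseline gains, driveline time constant and input
  effectiveness.  The state is (spacing error, velocity, acceleration, baseline control).
\<close>

definition A_mat :: "real \<Rightarrow> real \<Rightarrow> real \<Rightarrow> real \<Rightarrow> real \<Rightarrow> real^4^4" where
  "A_mat h kp kd T L = vector
     [vector [0, -1, -h, 0],
      vector [0, 0, 1, 0],
      vector [0, 0, -1 / T, L / T],
      vector [kp / h, -kd / h, -kd, -1 / h]]"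

definition Am_mat :: "real \<Rightarrow> real \<Rightarrow> real \<Rightarrow> real \<Rightarrow> real^4^4" where
  "Am_mat h kp kd \<tau>b = A_mat h kp kd \<tau>b 1"

definition Bw_mat :: "real \<Rightarrow> real \<Rightarrow> real^2^4" where
  "Bw_mat h kd = vector
     [vector [1, 0],
      vector [0, 0],
      vector [0, 0],
      vector [kd / h, 1 / h]]"

definition Bu_vec :: "real^4" where
  "Bu_vec = vector [0, 0, 1, 0]"

definition kx_vec :: "real \<Rightarrow> real \<Rightarrow> real \<Rightarrow> real^4" where
  "kx_vec \<tau>b T L = vector [0, 0, (\<tau>b - T) / (L * \<tau>b), (T - L * \<tau>b) / (L * \<tau>b)]"

text \<open>
  Signal \<open>(v, u\<^sub>b\<^sub>l)\<close> received by vehicle \<open>j\<close> from vehicle \<open>j - 1\<close>; \<open>v0\<close> and \<open>u0\<close> are the leader's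
  signals.
\<close>

definition w_prev :: "(real \<Rightarrow> real) \<Rightarrow> (real \<Rightarrow> real) \<Rightarrow> (nat \<Rightarrow> real \<Rightarrow> real^4) \<Rightarrow> nat \<Rightarrow> real \<Rightarrow> real^2" where
  "w_prev v0 u0 x j t =
     (if j = 1 then vector [v0 t, u0 t] else vector [x (j - 1) t $ 2, x (j - 1) t $ 4])"

text \<open>
  Right-hand side \<open>- \<Gamma> \<psi>'(\<parallel>e\<parallel>) x e\<^sup>T P B\<^sub>u\<close> of the adaptive law, \<open>e\<close> being the tracking error and
  \<open>x\<close> the actual state.
\<close>

definition adapt_law :: "real \<Rightarrow> real^4^4 \<Rightarrow> real^4^4 \<Rightarrow> real^4 \<Rightarrow> real^4 \<Rightarrow> real^4" where
  "adapt_law c P \<Gamma> x e =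
     - ((psi' c (wnorm P e) * (e \<bullet> (P *v Bu_vec))) *\<^sub>R (\<Gamma> *v x))"

text \<open>
  Actual vehicles \<open>x j\<close> under the control input \<open>k j t \<bullet> x j t\<close>, reference vehicles \<open>xr j\<close> and
  adaptive gains \<open>k j\<close>, over the time set \<open>I\<close>.
\<close>

definition closed_loop ::
  "nat \<Rightarrow> real \<Rightarrow> real \<Rightarrow> real \<Rightarrow> real \<Rightarrow> real \<Rightarrow> real^4^4 \<Rightarrow> (nat \<Rightarrow> real) \<Rightarrow> (nat \<Rightarrow> real) \<Rightarrow> (nat \<Rightarrow> real^4^4)
   \<Rightarrow> (real \<Rightarrow> real) \<Rightarrow> (real \<Rightarrow> real) \<Rightarrow> real set
   \<Rightarrow> (nat \<Rightarrow> real \<Rightarrow> real^4) \<Rightarrow> (nat \<Rightarrow> real \<Rightarrow> real^4) \<Rightarrow> (nat \<Rightarrow> real \<Rightarrow> real^4) \<Rightarrow> bool" where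
  "closed_loop N h kp kd \<tau>b c P \<tau> \<Lambda> \<Gamma> v0 u0 I x xr k \<longleftrightarrow>
     (\<forall>j\<in>{1..N}.
        ode_sol (\<lambda>t \<xi>. A_mat h kp kd (\<tau> j) (\<Lambda> j) *v \<xi> + Bw_mat h kd *v w_prev v0 u0 x j t
                        + (\<Lambda> j / \<tau> j * (k j t \<bullet> \<xi>)) *\<^sub>R Bu_vec) I (x j) \<and>
        ode_sol (\<lambda>t \<xi>. Am_mat h kp kd \<tau>b *v \<xi> + Bw_mat h kd *v w_prev v0 u0 x j t) I (xr j) \<and>
        ode_sol (\<lambda>t \<kappa>. adapt_law c P (\<Gamma> j) (x j t) (x j t - xr j t)) I (k j))"

text \<open>
  Error dynamics of one vehicle, in the pair (tracking error, gain error), driven by the reference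
  trajectory \<open>xr\<close>; \<open>T\<close> and \<open>L\<close> are the vehicle's time constant and input effectiveness.
\<close>

definition error_dynamics ::
  "real \<Rightarrow> real \<Rightarrow> real \<Rightarrow> real \<Rightarrow> real \<Rightarrow> real^4^4 \<Rightarrow> real \<Rightarrow> real \<Rightarrow> real^4^4 \<Rightarrow> (real \<Rightarrow> real^4)
   \<Rightarrow> real \<Rightarrow> (real^4) \<times> (real^4) \<Rightarrow> (real^4) \<times> (real^4)" where
  "error_dynamics h kp kd \<tau>b c P T L \<Gamma> xr t = (\<lambda>(e, \<kappa>).
     (Am_mat h kp kd \<tau>b *v e + (L / T * (\<kappa> \<bullet> (e + xr t))) *\<^sub>R Bu_vec,
      adapt_law c P \<Gamma> (e + xr t) e))"

subsection \<open>The error dynamics are those of the closed loop\<close>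

lemma vector_4:
  "(vector [a, b, c, d] :: 'a::zero^4) $ 1 = a"
  "(vector [a, b, c, d] :: 'a::zero^4) $ 2 = b"
  "(vector [a, b, c, d] :: 'a::zero^4) $ 3 = c"
  "(vector [a, b, c, d] :: 'a::zero^4) $ 4 = d"
  by (simp_all add: vector_def)

lemma matching_condition:
  assumes "T > 0" "L > 0" "\<tau>b > 0"
  shows "Am_mat h kp kd \<tau>b *v v
           = A_mat h kp kd T L *v v + (L / T * (kx_vec \<tau>b T L \<bullet> v)) *\<^sub>R Bu_vec"
  using assms
  by (simp add: vec_eq_iff forall_4 matrix_vector_mult_def sum_4 inner_vec_def Am_mat_def A_mat_def
      kx_vec_def Bu_vec_def vector_4 field_simps)

lemma closed_loop_error_dynamics:
  assumes cl: "closed_loop N h kp kd \<tau>b c P \<tau> \<Lambda> \<Gamma> v0 u0 I x xr k"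
    and j: "j \<in> {1..N}" and pos: "\<tau> j > 0" "\<Lambda> j > 0" "\<tau>b > 0"
  shows "ode_sol (error_dynamics h kp kd \<tau>b c P (\<tau> j) (\<Lambda> j) (\<Gamma> j) (xr j)) I
           (\<lambda>t. (x j t - xr j t, k j t - kx_vec \<tau>b (\<tau> j) (\<Lambda> j)))"
  unfolding ode_sol_def
proof
  fix t assume t: "t \<in> I"
  let ?w = "Bw_mat h kd *v w_prev v0 u0 x j t"
  have dx: "(x j has_vector_derivative A_mat h kp kd (\<tau> j) (\<Lambda> j) *v x j t + ?w
        + (\<Lambda> j / \<tau> j * (k j t \<bullet> x j t)) *\<^sub>R Bu_vec) (at t within I)"
    and dr: "(xr j has_vector_derivative Am_mat h kp kd \<tau>b *v xr j t + ?w) (at t within I)"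
    and dk: "(k j has_vector_derivative adapt_law c P (\<Gamma> j) (x j t) (x j t - xr j t)) (at t within I)"
    using cl j t unfolding closed_loop_def ode_sol_def by blast+
  have eq: "A_mat h kp kd (\<tau> j) (\<Lambda> j) *v x j t + ?w + (\<Lambda> j / \<tau> j * (k j t \<bullet> x j t)) *\<^sub>R Bu_vec
      - (Am_mat h kp kd \<tau>b *v xr j t + ?w)
      = Am_mat h kp kd \<tau>b *v (x j t - xr j t)
        + (\<Lambda> j / \<tau> j * ((k j t - kx_vec \<tau>b (\<tau> j) (\<Lambda> j)) \<bullet> x j t)) *\<^sub>R Bu_vec"
    by (simp add: matrix_vector_mult_diff_distrib inner_diff_left right_diff_distrib scaleR_diff_left
        matching_condition[OF pos, of _ _ _ "x j t"])
  show "((\<lambda>t. (x j t - xr j t, k j t - kx_vec \<tau>b (\<tau> j) (\<Lambda> j))) has_vector_derivative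
      error_dynamics h kp kd \<tau>b c P (\<tau> j) (\<Lambda> j) (\<Gamma> j) (xr j) t
        (x j t - xr j t, k j t - kx_vec \<tau>b (\<tau> j) (\<Lambda> j))) (at t within I)"
    using has_vector_derivative_Pair[OF has_vector_derivative_diff[OF dx dr]
        has_vector_derivative_diff[OF dk has_vector_derivative_const]]
    unfolding eq by (simp add: error_dynamics_def)
qed

end

theory Submission
  imports Defs
begin

text \<open>
  Along the error dynamics the function
  \<open>V = \<psi>(\<parallel>e\<parallel>\<^sub>P) + \<theta> \<kappa>\<^sup>T \<Gamma>\<inverse> \<kappa>\<close> has derivative \<open>- \<psi>'(\<parallel>e\<parallel>\<^sub>P) e\<^sup>T Q e \<le> 0\<close> as long as
  \<open>\<parallel>e\<parallel>\<^sub>P < c\<close>: the adaptive law cancels the term that is bilinear in \<open>\<kappa>\<close> and \<open>x\<close>.  Hence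
  \<open>\<psi>(\<parallel>e\<parallel>\<^sub>P) \<le> V(0)\<close>, which keeps \<open>\<parallel>e\<parallel>\<^sub>P\<close> below a constant \<open>c' < c\<close>, so the barrier is never
  reached.  Since \<open>V\<close> also dominates a multiple of \<open>\<parallel>(e, \<kappa>)\<parallel>\<^sup>2\<close>, the origin is stable and
  solutions cannot escape in finite time.  The whole platoon is solved vehicle by vehicle, each one
  being driven by its predecessor.
\<close>

subsection \<open>Ordinary differential equations\<close>

lemma ode_sol_imp_continuous_on:
  assumes "ode_sol f I y"
  shows "continuous_on I y"
  using assms unfolding ode_sol_def
  by (intro continuous_on_vector_derivative) auto

lemma ode_sol_subset:
  assumes "ode_sol f I y" "J \<subseteq> I"
  shows "ode_sol f J y"
  using assms unfolding ode_sol_def by (meson has_vector_derivative_within_subset subsetD)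

lemma ode_sol_cong:
  assumes "ode_sol f I y" "\<And>t. t \<in> I \<Longrightarrow> f t (y t) = g t (y t)"
  shows "ode_sol g I y"
  using assms unfolding ode_sol_def by simp

lemma forward_interval_segment:
  assumes "forward_interval t0 I" "t \<in> I"
  shows "{t0..t} \<subseteq> I"
  using assms unfolding forward_interval_def is_interval_1 by auto

text \<open>A derivative at \<open>t\<close> only sees a neighbourhood of \<open>t\<close>, and
  there \<open>{a..t+1}\<close> agrees with \<open>{a..}\<close>; so the fundamental theorem of
  calculus on a compact interval suffices.\<close>

lemma integral_has_vector_derivative_halfline:
  fixes g :: "real \<Rightarrow> 'a::banach"
  assumes "continuous_on {a..} g" "a \<le> t"
  shows "((\<lambda>u. integral {a..u} g) has_vector_derivative g t) (at t within {a..})"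
proof -
  have "((\<lambda>u. integral {a..u} g) has_vector_derivative g t) (at t within {a..t+1})"
    using assms by (intro integral_has_vector_derivative) (auto intro: continuous_on_subset)
  moreover have "at t within {a..t+1} = at t within {a..}"
    using assms by (intro at_within_nhd[of t "{..<t+1}"]) auto
  ultimately show ?thesis by simp
qed

section \<open>Global solutions by Picard iteration\<close>

fun picard :: "(real \<Rightarrow> 'a \<Rightarrow> 'a) \<Rightarrow> real \<Rightarrow> 'a::euclidean_space \<Rightarrow> nat \<Rightarrow> real \<Rightarrow> 'a" where
  "picard f t0 y0 0 t = y0"
| "picard f t0 y0 (Suc n) t = y0 + integral {t0..t} (\<lambda>s. f s (picard f t0 y0 n s))"

text \<open>The Lipschitz constant may grow with \<open>T\<close> but is uniform in the state.
  Measured against an exponential weight, consecutive Picard iterates contract on every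
  \<open>{t0..T}\<close> whatever its length, so one iteration converges on the whole half-line and
  no short-time solutions have to be glued.\<close>

theorem global_ode_solution:
  fixes f :: "real \<Rightarrow> 'a::euclidean_space \<Rightarrow> 'a"
  assumes cont: "continuous_on ({t0..} \<times> UNIV) (\<lambda>(t, y). f t y)"
    and lip: "\<And>T. \<exists>L\<ge>0. \<forall>t\<in>{t0..T}. \<forall>y z. norm (f t y - f t z) \<le> L * norm (y - z)"
  shows "\<exists>y. ode_sol f {t0..} y \<and> y t0 = y0"
proof -
  define Y where "Y = picard f t0 y0"
  define D where "D n t = Y (Suc n) t - Y n t" for n t
  have cf: "continuous_on S (\<lambda>s. f s (y s))" if "continuous_on S y" "S \<subseteq> {t0..}" for S y
  proof -
    have "continuous_on S (\<lambda>s. (s, y s))" using that by (intro continuous_intros)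
    moreover have "(\<lambda>s. (s, y s)) ` S \<subseteq> {t0..} \<times> UNIV" using that(2) by blast
    ultimately show ?thesis
      using continuous_on_compose2[OF cont, of S "\<lambda>s. (s, y s)"] by simp
  qed
  have Y0: "Y n t0 = y0" for n
    by (cases n) (simp_all add: Y_def)
  have Yd: "(Y (Suc n) has_vector_derivative f t (Y n t)) (at t within {t0..})"
    if "continuous_on {t0..} (Y n)" "t \<ge> t0" for n t
  proof -
    have "((\<lambda>t. y0 + integral {t0..t} (\<lambda>s. f s (Y n s))) has_vector_derivative 0 + f t (Y n t)) (at t within {t0..})"
      by (intro has_vector_derivative_add has_vector_derivative_const
          integral_has_vector_derivative_halfline cf that order_refl)
    moreover have "(\<lambda>t. y0 + integral {t0..t} (\<lambda>s. f s (Y n s))) = Y (Suc n)"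
      by (simp add: Y_def fun_eq_iff)
    ultimately show ?thesis by simp
  qed
  have Yc: "continuous_on {t0..} (Y n)" for n
  proof (induction n)
    case 0
    then show ?case by (simp add: Y_def)
  next
    case (Suc n)
    then show ?case
      using Yd by (intro continuous_on_vector_derivative) auto
  qed
  note Yd = Yd[OF Yc]
  \<comment> \<open>Consecutive iterates approach each other geometrically, uniformly on each
    compact time interval.\<close>
  have key: "\<exists>C\<ge>0. \<forall>n. \<forall>t\<in>{t0..T}. norm (D n t) \<le> C * (1/2) ^ n" if T: "t0 \<le> T" for T
  proof -
    obtain L where L: "L \<ge> 0" "\<And>t y z. t \<in> {t0..T} \<Longrightarrow> norm (f t y - f t z) \<le> L * norm (y - z)"
      using lip by blast
    have "compact ((\<lambda>t. D 0 t) ` {t0..T})"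
      unfolding D_def
      by (intro compact_continuous_image continuous_intros continuous_on_subset[OF Yc]) auto
    then obtain M where M: "\<And>t. t \<in> {t0..T} \<Longrightarrow> norm (D 0 t) \<le> M" "M \<ge> 0"
      using T unfolding bounded_iff by (metis atLeastAtMost_iff compact_imp_bounded bounded_pos
          image_eqI less_eq_real_def)
    \<comment> \<open>With rate \<open>2 * L\<close>, integrating \<open>L\<close> times the weight
      gives at most half the weight; this is the contraction factor 1/2.\<close>
    define E where "E t = exp (2 * L * (t - t0))" for t
    have E: "1 \<le> E t" if "t \<ge> t0" for t
      using that L by (simp add: E_def)
    have step: "norm (D n t) \<le> M * (1/2) ^ n * E t" if "t \<in> {t0..T}" for n t
      using that
    proof (induction n arbitrary: t)
      case 0
      then have "norm (D 0 t) \<le> M * 1" "M * 1 \<le> M * E t"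
        using M(1)[of t] mult_left_mono[OF E M(2), of t] by auto
      then show ?case by simp
    next
      case (Suc n)
      show ?case
      proof (cases "t = t0")
        case True
        then show ?thesis using M by (simp add: D_def Y0 E_def)
      next
        case False
        \<comment> \<open>The derivative of this majorant is exactly \<open>L\<close> times the
          bound already known for \<open>D n\<close>, so the mean value inequality carries the bound
          to \<open>D (Suc n)\<close>, which vanishes at \<open>t0\<close>.\<close>
        define \<phi> where "\<phi> s = M * (1/2) ^ Suc n * E s" for s
        have nhd: "at s within {t0..} = at s" if "s > t0" for s
          using that by (intro at_within_interior) auto
        have "norm (D (Suc n) t - D (Suc n) t0) \<le> \<phi> t - \<phi> t0"
        proof (rule differentiable_bound_general)
          show "t0 < t" using False Suc.prems by auto
          show "continuous_on {t0..t} (D (Suc n))"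
            unfolding D_def by (intro continuous_intros continuous_on_subset[OF Yc]) auto
          show "continuous_on {t0..t} \<phi>"
            unfolding \<phi>_def E_def by (intro continuous_intros)
          fix s assume s: "t0 < s" "s < t"
          show "(D (Suc n) has_vector_derivative (f s (Y (Suc n) s) - f s (Y n s))) (at s)"
            using has_vector_derivative_diff[OF Yd[of s "Suc n"] Yd[of s n]] s nhd[of s]
            by (simp add: D_def[abs_def])
          show "(\<phi> has_vector_derivative L * (M * (1/2) ^ n * E s)) (at s)"
            unfolding \<phi>_def E_def has_real_derivative_iff_has_vector_derivative[symmetric]
            by (auto intro!: derivative_eq_intros)
          have "norm (f s (Y (Suc n) s) - f s (Y n s)) \<le> L * norm (D n s)"
            unfolding D_def using L(2)[of s] s Suc.prems by auto
          also have "\<dots> \<le> L * (M * (1/2) ^ n * E s)"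
            using Suc.IH[of s] s Suc.prems L(1) by (intro mult_left_mono) auto
          finally show "norm (f s (Y (Suc n) s) - f s (Y n s)) \<le> L * (M * (1/2) ^ n * E s)" .
        qed
        moreover have "D (Suc n) t0 = 0" by (simp add: D_def Y0)
        moreover have "\<phi> t0 \<ge> 0" using M by (simp add: \<phi>_def E_def)
        ultimately show ?thesis by (simp add: \<phi>_def)
      qed
    qed
    show ?thesis
    proof (intro exI[of _ "M * E T"] conjI allI ballI)
      show "0 \<le> M * E T" using M by (simp add: E_def)
      fix n t assume t: "t \<in> {t0..T}"
      have "norm (D n t) \<le> M * (1/2) ^ n * E t" by (rule step[OF t])
      also have "\<dots> \<le> M * (1/2) ^ n * E T"
        using t M L by (intro mult_left_mono) (auto simp: E_def mult_left_mono)
      finally show "norm (D n t) \<le> M * E T * (1/2) ^ n" by (simp add: mult_ac)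
    qed
  qed
  \<comment> \<open>The limit is written as a telescoping series, so that the M-test with the
    geometric bounds gives uniform convergence on compact intervals.\<close>
  define y where "y t = y0 + (\<Sum>n. D n t)" for t
  have sumD: "y0 + (\<Sum>i<n. D i t) = Y n t" for n t
    unfolding D_def by (subst sum_lessThan_telescope) (simp add: Y_def)
  have ul: "uniform_limit {t0..T} Y y sequentially" if T: "t0 \<le> T" for T
  proof -
    obtain C where C: "\<And>n t. t \<in> {t0..T} \<Longrightarrow> norm (D n t) \<le> C * (1/2) ^ n"
      using key[OF T] by blast
    have "uniform_limit {t0..T} (\<lambda>n t. \<Sum>i<n. D i t) (\<lambda>t. \<Sum>i. D i t) sequentially"
      by (rule Weierstrass_m_test[OF C]) (auto intro!: summable_mult)
    then have "uniform_limit {t0..T} (\<lambda>n t. y0 + (\<Sum>i<n. D i t)) (\<lambda>t. y0 + (\<Sum>i. D i t)) sequentially"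
      by (intro uniform_limit_intros)
    then show ?thesis by (simp add: sumD y_def[abs_def])
  qed
  have ycT: "continuous_on {t0..T} y" if "t0 \<le> T" for T
    by (rule uniform_limit_theorem[OF _ ul[OF that]])
       (auto intro!: always_eventually continuous_on_subset[OF Yc])
  \<comment> \<open>The Lipschitz bound transports uniform convergence from the iterates to the
    integrands, so the limit passes under the integral in the Picard recursion.\<close>
  have yeq: "y t = y0 + integral {t0..t} (\<lambda>s. f s (y s))" if t: "t0 \<le> t" for t
  proof -
    obtain L where L: "L \<ge> 0" "\<And>s y z. s \<in> {t0..t} \<Longrightarrow> norm (f s y - f s z) \<le> L * norm (y - z)"
      using lip by blast
    have "uniform_limit {t0..t} (\<lambda>n s. f s (Y n s)) (\<lambda>s. f s (y s)) sequentially"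
    proof (rule uniform_limitI)
      fix e :: real assume e: "e > 0"
      \<comment> \<open>Dividing by \<open>L + 1\<close> rather than \<open>L\<close> covers
        \<open>L = 0\<close> and makes the final inequality strict.\<close>
      have "\<forall>\<^sub>F n in sequentially. \<forall>s\<in>{t0..t}. dist (Y n s) (y s) < e / (L + 1)"
        using e L(1) by (intro uniform_limitD[OF ul[OF t]]) auto
      then show "\<forall>\<^sub>F n in sequentially. \<forall>s\<in>{t0..t}. dist (f s (Y n s)) (f s (y s)) < e"
      proof (eventually_elim, intro ballI)
        fix n s assume *: "\<forall>s\<in>{t0..t}. dist (Y n s) (y s) < e / (L + 1)" and s: "s \<in> {t0..t}"
        have "dist (f s (Y n s)) (f s (y s)) \<le> L * dist (Y n s) (y s)"
          unfolding dist_norm by (rule L(2)[OF s])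
        also have "\<dots> \<le> L * (e / (L + 1))"
          using * s L(1) by (intro mult_left_mono) (auto intro: less_imp_le)
        also have "\<dots> < e" using e L(1) by (simp add: field_simps)
        finally show "dist (f s (Y n s)) (f s (y s)) < e" .
      qed
    qed
    moreover have "continuous_on {t0..t} (\<lambda>s. f s (Y n s))" for n
      by (intro cf continuous_on_subset[OF Yc]) auto
    ultimately obtain I J where IJ: "\<And>n. ((\<lambda>s. f s (Y n s)) has_integral I n) {t0..t}"
        "((\<lambda>s. f s (y s)) has_integral J) {t0..t}" "I \<longlonglongrightarrow> J"
      by (rule uniform_limit_integral) auto
    then have "(\<lambda>n. integral {t0..t} (\<lambda>s. f s (Y n s))) \<longlonglongrightarrow> integral {t0..t} (\<lambda>s. f s (y s))"
      by (simp add: integral_unique[OF IJ(1)] integral_unique[OF IJ(2)])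
    then have "(\<lambda>n. Y (Suc n) t) \<longlonglongrightarrow> y0 + integral {t0..t} (\<lambda>s. f s (y s))"
      by (simp add: Y_def tendsto_add)
    moreover have "(\<lambda>n. Y n t) \<longlonglongrightarrow> y t"
      using tendsto_uniform_limitI[OF ul[OF t]] t by simp
    ultimately show ?thesis
      using LIMSEQ_unique LIMSEQ_Suc by blast
  qed
  have yc: "continuous_on {t0..} y"
    unfolding continuous_on_eq_continuous_within
  proof
    fix t assume t: "t \<in> {t0..}"
    have "continuous (at t within {t0..t+1}) y"
      using ycT[of "t+1"] t by (simp add: continuous_on_eq_continuous_within)
    moreover have "at t within {t0..t+1} = at t within {t0..}"
      using t by (intro at_within_nhd[of t "{..<t+1}"]) auto
    ultimately show "continuous (at t within {t0..}) y" by simp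
  qed
  have "ode_sol f {t0..} y"
    unfolding ode_sol_def
  proof
    fix t assume t: "t \<in> {t0..}"
    have "((\<lambda>t. y0 + integral {t0..t} (\<lambda>s. f s (y s))) has_vector_derivative 0 + f t (y t)) (at t within {t0..})"
      using t by (intro has_vector_derivative_add has_vector_derivative_const
          integral_has_vector_derivative_halfline cf yc) auto
    then have "((\<lambda>t. y0 + integral {t0..t} (\<lambda>s. f s (y s))) has_vector_derivative f t (y t)) (at t within {t0..})"
      by simp
    then show "(y has_vector_derivative f t (y t)) (at t within {t0..})"
      by (rule has_vector_derivative_transform[OF t, rotated]) (use yeq in auto)
  qed
  moreover have "y t0 = y0" using yeq[of t0] by simp
  ultimately show ?thesis by blast
qed

text \<open>A continuity argument for a priori estimates that hold only while the trajectory stays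
  in \<open>U\<close> but then yield the sharper region \<open>K\<close>. Before a first exit time
  from \<open>U\<close> the trajectory lies in \<open>K\<close>; since \<open>K\<close> is closed,
  it is still in \<open>K\<close>, hence in \<open>U\<close>, at the exit time itself, a
  contradiction.\<close>

lemma first_exit_invariance:
  fixes y :: "real \<Rightarrow> 'a::metric_space"
  assumes I: "forward_interval t0 I" and cy: "continuous_on I y"
    and "closed K" "open U" "K \<subseteq> U" "y t0 \<in> U"
    and imp: "\<And>t. t \<in> I \<Longrightarrow> (\<And>s. s \<in> {t0..t} \<Longrightarrow> y s \<in> U) \<Longrightarrow> y t \<in> K"
  shows "\<forall>t\<in>I. y t \<in> K"
proof -
  have inU: "y t \<in> U" if t: "t \<in> I" for t
  proof (rule ccontr)
    assume neg: "y t \<notin> U"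
    have sub: "{t0..t} \<subseteq> I" by (rule forward_interval_segment[OF I t])
    then have cy': "continuous_on {t0..t} y" using cy continuous_on_subset by blast
    have t0t: "t0 \<le> t" using I t by (auto simp: forward_interval_def)
    define Z where "Z = {s \<in> {t0..t}. y s \<in> - U}"
    have Z': "Z = {t0..t} \<inter> y -` (- U)" by (auto simp: Z_def)
    have "closed Z"
      unfolding Z' using \<open>open U\<close> by (intro continuous_closed_preimage[OF cy']) auto
    moreover have "bounded Z"
      by (rule bounded_subset[of "{t0..t}"]) (auto simp: Z_def)
    ultimately have "compact Z"
      by (simp add: compact_eq_bounded_closed)
    moreover have "t \<in> Z" using neg t0t by (simp add: Z_def)
    \<comment> \<open>\<open>s\<close> is the first exit time: the exit times up to \<open>t\<close>
      form a nonempty compact set.\<close>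
    ultimately obtain s where s: "s \<in> Z" "\<And>r. r \<in> Z \<Longrightarrow> s \<le> r"
      using compact_attains_inf[of Z] by (metis empty_iff)
    have "s \<noteq> t0" "s \<ge> t0" using s(1) \<open>y t0 \<in> U\<close> by (auto simp: Z_def)
    then have "s > t0" by simp
    have *: "y r \<in> K" if r: "r \<in> {t0..<s}" for r
    proof (rule imp)
      show "r \<in> I" using r s sub by (auto simp: Z_def)
      fix q assume "q \<in> {t0..r}"
      then show "y q \<in> U" using s r by (fastforce simp: Z_def)
    qed
    \<comment> \<open>\<open>y s\<close> is a limit from the left of points of \<open>K\<close>;
      \<open>s > t0\<close> makes this left neighbourhood nontrivial.\<close>
    have "(y \<longlongrightarrow> y s) (at s within {t0..<s})"
      using cy' s(1) unfolding continuous_on_def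
      by (auto simp: Z_def intro: tendsto_within_subset[of y _ s "{t0..t}"])
    moreover have "at s within {t0..<s} \<noteq> bot"
      using \<open>s > t0\<close> by (simp add: trivial_limit_within islimpt_Ico)
    moreover have "\<forall>\<^sub>F r in at s within {t0..<s}. y r \<in> K"
      using * by (auto simp: eventually_at_filter)
    ultimately have "y s \<in> K"
      using Lim_in_closed_set[OF \<open>closed K\<close>] by blast
    then show False using s(1) \<open>K \<subseteq> U\<close> by (auto simp: Z_def)
  qed
  show ?thesis
    using inU imp forward_interval_segment[OF I] by blast
qed

subsection \<open>Families of bounded Lipschitz functions\<close>

text \<open>Boundedness is carried along with the Lipschitz property because products of Lipschitz
  functions are Lipschitz only when the factors are bounded. The constant is uniform in the
  parameter \<open>t\<close>, which will be time.\<close>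

definition lip_bounded :: "'p set \<Rightarrow> 'a set \<Rightarrow> ('p \<Rightarrow> 'a::real_normed_vector \<Rightarrow> 'b::real_normed_vector) \<Rightarrow> bool" where
  "lip_bounded A S g \<longleftrightarrow> (\<exists>C\<ge>0. \<forall>t\<in>A. \<forall>y\<in>S. norm (g t y) \<le> C \<and>
     (\<forall>z\<in>S. norm (g t y - g t z) \<le> C * norm (y - z)))"

lemma lip_boundedI:
  assumes "\<And>t y. t \<in> A \<Longrightarrow> y \<in> S \<Longrightarrow> norm (g t y) \<le> B"
    and "\<And>t y z. t \<in> A \<Longrightarrow> y \<in> S \<Longrightarrow> z \<in> S \<Longrightarrow> norm (g t y - g t z) \<le> L * norm (y - z)"
  shows "lip_bounded A S g"
  unfolding lip_bounded_def
proof (intro exI[of _ "max 0 (max B L)"] conjI ballI)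
  fix t y z assume *: "t \<in> A" "y \<in> S" "z \<in> S"
  have "norm (g t y - g t z) \<le> L * norm (y - z)" using assms(2) * by blast
  also have "\<dots> \<le> max 0 (max B L) * norm (y - z)" by (intro mult_right_mono) auto
  finally show "norm (g t y - g t z) \<le> max 0 (max B L) * norm (y - z)" .
qed (use assms(1) in \<open>force+\<close>)

lemma lip_boundedE:
  assumes "lip_bounded A S g"
  obtains C where "C \<ge> 0" "\<And>t y. t \<in> A \<Longrightarrow> y \<in> S \<Longrightarrow> norm (g t y) \<le> C"
    "\<And>t y z. t \<in> A \<Longrightarrow> y \<in> S \<Longrightarrow> z \<in> S \<Longrightarrow> norm (g t y - g t z) \<le> C * norm (y - z)"
  using assms unfolding lip_bounded_def by blast

lemma lip_bounded_param:
  assumes "bounded (r ` A)"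
  shows "lip_bounded A S (\<lambda>t y. r t)"
proof -
  obtain B where "\<And>t. t \<in> A \<Longrightarrow> norm (r t) \<le> B"
    using assms unfolding bounded_iff by auto
  then show ?thesis by (intro lip_boundedI[of _ _ _ B 0]) auto
qed

lemma lip_bounded_const: "lip_bounded A S (\<lambda>t y. k)"
  by (intro lip_boundedI[of _ _ _ "norm k" 0]) auto

lemma lip_bounded_id:
  assumes "bounded S"
  shows "lip_bounded A S (\<lambda>t y. y)"
proof -
  obtain B where "\<And>y. y \<in> S \<Longrightarrow> norm y \<le> B"
    using assms unfolding bounded_iff by auto
  then show ?thesis by (intro lip_boundedI[of _ _ _ B 1]) auto
qed

lemma lip_bounded_linear:
  assumes f: "bounded_linear f" and g: "lip_bounded A S g"
  shows "lip_bounded A S (\<lambda>t y. f (g t y))"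
proof -
  interpret f: bounded_linear f by fact
  obtain K where K: "K \<ge> 0" "\<And>x. norm (f x) \<le> K * norm x"
    using f.nonneg_bounded by (auto simp: mult.commute)
  obtain C where C: "C \<ge> 0" "\<And>t y. t \<in> A \<Longrightarrow> y \<in> S \<Longrightarrow> norm (g t y) \<le> C"
    "\<And>t y z. t \<in> A \<Longrightarrow> y \<in> S \<Longrightarrow> z \<in> S \<Longrightarrow> norm (g t y - g t z) \<le> C * norm (y - z)"
    using lip_boundedE[OF g] by blast
  show ?thesis
  proof (rule lip_boundedI)
    fix t y z assume *: "t \<in> A" "y \<in> S" "z \<in> S"
    show "norm (f (g t y)) \<le> K * C"
      using K(2)[of "g t y"] mult_left_mono[OF C(2)[OF *(1,2)] K(1)] by linarith
    show "norm (f (g t y) - f (g t z)) \<le> (K * C) * norm (y - z)"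
      using K(2)[of "g t y - g t z"] mult_left_mono[OF C(3)[OF *] K(1)] by (simp add: f.diff)
  qed
qed

lemma lip_bounded_add:
  assumes "lip_bounded A S f" "lip_bounded A S g"
  shows "lip_bounded A S (\<lambda>t y. f t y + g t y)"
proof -
  obtain C where C: "C \<ge> 0" "\<And>t y. t \<in> A \<Longrightarrow> y \<in> S \<Longrightarrow> norm (f t y) \<le> C"
    "\<And>t y z. t \<in> A \<Longrightarrow> y \<in> S \<Longrightarrow> z \<in> S \<Longrightarrow> norm (f t y - f t z) \<le> C * norm (y - z)"
    using lip_boundedE[OF assms(1)] by blast
  obtain D where D: "D \<ge> 0" "\<And>t y. t \<in> A \<Longrightarrow> y \<in> S \<Longrightarrow> norm (g t y) \<le> D"
    "\<And>t y z. t \<in> A \<Longrightarrow> y \<in> S \<Longrightarrow> z \<in> S \<Longrightarrow> norm (g t y - g t z) \<le> D * norm (y - z)"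
    using lip_boundedE[OF assms(2)] by blast
  show ?thesis
  proof (rule lip_boundedI)
    fix t y z assume *: "t \<in> A" "y \<in> S" "z \<in> S"
    show "norm (f t y + g t y) \<le> C + D"
      using C(2)[OF *(1,2)] D(2)[OF *(1,2)] by (rule norm_triangle_mono)
    have "norm ((f t y - f t z) + (g t y - g t z)) \<le> C * norm (y - z) + D * norm (y - z)"
      using C(3)[OF *] D(3)[OF *] by (rule norm_triangle_mono)
    then show "norm (f t y + g t y - (f t z + g t z)) \<le> (C + D) * norm (y - z)"
      by (simp add: algebra_simps)
  qed
qed

text \<open>The product rule split: change one factor at a time and estimate the other by its
  uniform bound.\<close>

lemma lip_bounded_bilinear:
  assumes p: "bounded_bilinear p" and "lip_bounded A S f" "lip_bounded A S g"
  shows "lip_bounded A S (\<lambda>t y. p (f t y) (g t y))"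
proof -
  interpret p: bounded_bilinear p by fact
  obtain K where K: "K \<ge> 0" "\<And>a b. norm (p a b) \<le> norm a * norm b * K"
    using p.nonneg_bounded by blast
  obtain C where C: "C \<ge> 0" "\<And>t y. t \<in> A \<Longrightarrow> y \<in> S \<Longrightarrow> norm (f t y) \<le> C"
    "\<And>t y z. t \<in> A \<Longrightarrow> y \<in> S \<Longrightarrow> z \<in> S \<Longrightarrow> norm (f t y - f t z) \<le> C * norm (y - z)"
    using lip_boundedE[OF assms(2)] by blast
  obtain D where D: "D \<ge> 0" "\<And>t y. t \<in> A \<Longrightarrow> y \<in> S \<Longrightarrow> norm (g t y) \<le> D"
    "\<And>t y z. t \<in> A \<Longrightarrow> y \<in> S \<Longrightarrow> z \<in> S \<Longrightarrow> norm (g t y - g t z) \<le> D * norm (y - z)"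
    using lip_boundedE[OF assms(3)] by blast
  have le: "norm (p a b) \<le> a' * b' * K" if "norm a \<le> a'" "norm b \<le> b'" "a' \<ge> 0" for a b a' b'
    using K(2)[of a b] mult_right_mono[OF mult_mono[OF that(1,2,3)] K(1)] by auto
  show ?thesis
  proof (rule lip_boundedI)
    fix t y z assume *: "t \<in> A" "y \<in> S" "z \<in> S"
    show "norm (p (f t y) (g t y)) \<le> C * D * K"
      by (rule le[OF C(2)[OF *(1,2)] D(2)[OF *(1,2)] C(1)])
    have "norm (p (f t y - f t z) (g t y) + p (f t z) (g t y - g t z))
        \<le> C * norm (y - z) * D * K + C * (D * norm (y - z)) * K"
      by (rule norm_triangle_mono[OF le[OF C(3)[OF *] D(2)[OF *(1,2)]] le[OF C(2)[OF *(1,3)] D(3)[OF *]]])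
         (use C in auto)
    then show "norm (p (f t y) (g t y) - p (f t z) (g t z)) \<le> (2 * C * D * K) * norm (y - z)"
      by (simp add: p.diff_left p.diff_right algebra_simps)
  qed
qed

text \<open>Since 1/a - 1/b = (b - a)/(ab), staying at least \<open>d\<close> above zero costs a
  factor 1/d^2 in the Lipschitz constant.\<close>

lemma lip_bounded_inverse:
  fixes g :: "'p \<Rightarrow> 'a::real_normed_vector \<Rightarrow> real"
  assumes g: "lip_bounded A S g" and d: "d > 0" "\<And>t y. t \<in> A \<Longrightarrow> y \<in> S \<Longrightarrow> d \<le> g t y"
  shows "lip_bounded A S (\<lambda>t y. inverse (g t y))"
proof -
  obtain C where C: "C \<ge> 0" "\<And>t y. t \<in> A \<Longrightarrow> y \<in> S \<Longrightarrow> norm (g t y) \<le> C"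
    "\<And>t y z. t \<in> A \<Longrightarrow> y \<in> S \<Longrightarrow> z \<in> S \<Longrightarrow> norm (g t y - g t z) \<le> C * norm (y - z)"
    using lip_boundedE[OF g] by blast
  have inv: "norm (inverse (g t y)) \<le> inverse d" if "t \<in> A" "y \<in> S" for t y
    using d(2)[OF that] d(1) by (simp add: le_imp_inverse_le)
  show ?thesis
  proof (rule lip_boundedI[OF inv])
    fix t y z assume *: "t \<in> A" "y \<in> S" "z \<in> S"
    have nz: "g t y \<noteq> 0" "g t z \<noteq> 0" using d(1) d(2)[OF *(1,2)] d(2)[OF *(1,3)] by auto
    have "norm (inverse (g t y) - inverse (g t z))
        = norm (inverse (g t y)) * norm (g t y - g t z) * norm (inverse (g t z))"
      using nz by (simp add: division_ring_inverse_diff abs_mult abs_minus_commute)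
    also have "\<dots> \<le> inverse d * (C * norm (y - z)) * inverse d"
      using d(1) C by (intro mult_mono inv C(3) *) auto
    finally show "norm (inverse (g t y) - inverse (g t z)) \<le> (inverse d * C * inverse d) * norm (y - z)"
      by (simp add: mult_ac)
  qed
qed

subsection \<open>Positive definite matrices\<close>

lemma sym_pos_def_inner_commute:
  assumes "sym_pos_def M"
  shows "u \<bullet> (M *v v) = v \<bullet> (M *v u)"
proof -
  have "M *v v = transpose M *v v" using assms by (simp add: sym_pos_def_def)
  then have "u \<bullet> (M *v v) = (v v* M) \<bullet> u"
    by (metis inner_commute transpose_matrix_vector)
  then show ?thesis by (simp only: dot_lmul_matrix)
qed

lemma sym_pos_def_nonneg:
  assumes "sym_pos_def M"
  shows "v \<bullet> (M *v v) \<ge> 0"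
  using assms unfolding sym_pos_def_def by (cases "v = 0") (auto intro: less_imp_le)

text \<open>The constant is the minimum of the quadratic form on the unit sphere, attained by
  compactness and positive by definiteness; homogeneity extends the bound to all vectors.\<close>

lemma sym_pos_def_coercive:
  fixes M :: "real^'n^'n"
  assumes "sym_pos_def M"
  obtains m where "m > 0" "\<And>v. m * (norm v)\<^sup>2 \<le> v \<bullet> (M *v v)"
proof -
  have "continuous_on (sphere 0 1) (\<lambda>v. v \<bullet> (M *v v))"
    by (intro continuous_intros matrix_vector_mult_linear_continuous_on)
  from continuous_attains_inf[OF compact_sphere _ this]
  obtain u where u: "u \<in> sphere 0 1" "\<And>v. v \<in> sphere 0 1 \<Longrightarrow> u \<bullet> (M *v u) \<le> v \<bullet> (M *v v)"
    by fastforce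
  show thesis
  proof (rule that)
    show "u \<bullet> (M *v u) > 0" using u(1) assms unfolding sym_pos_def_def by (metis mem_sphere_0 norm_zero zero_neq_one)
    fix v :: "real^'n"
    show "u \<bullet> (M *v u) * (norm v)\<^sup>2 \<le> v \<bullet> (M *v v)"
    proof (cases "v = 0")
      case False
      have "u \<bullet> (M *v u) \<le> (v /\<^sub>R norm v) \<bullet> (M *v (v /\<^sub>R norm v))"
        using False by (intro u(2)) simp
      also have "\<dots> = (v \<bullet> (M *v v)) / (norm v)\<^sup>2"
        by (simp add: matrix_vector_mult_scaleR power2_eq_square field_simps)
      finally show ?thesis using False by (simp add: field_simps)
    qed simp
  qed
qed

text \<open>Definiteness makes the kernel trivial, so a left inverse exists and is two-sided.
  Transposing \<open>G ** H = mat 1\<close> gives symmetry, and writing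
  \<open>v = G *v (H *v v)\<close> gives positivity.\<close>

lemma sym_pos_def_inverse:
  fixes G :: "real^'n^'n"
  assumes G: "sym_pos_def G"
  obtains H where "sym_pos_def H" "\<And>v. H *v (G *v v) = v"
proof -
  have ker: "\<forall>v. G *v v = 0 \<longrightarrow> v = 0"
    using G unfolding sym_pos_def_def by (metis inner_zero_right less_irrefl)
  then obtain H where HG: "H ** G = mat 1" using matrix_left_invertible_ker[of G] by blast
  then have GH: "G ** H = mat 1" by (rule matrix_left_right_inverse1)
  have l: "H *v (G *v v) = v" and r: "G *v (H *v v) = v" for v
    using HG GH by (simp_all add: matrix_vector_mul_assoc)
  have "sym_pos_def H" unfolding sym_pos_def_def
  proof (intro conjI allI impI)
    have "transpose H ** G = mat 1"
      using arg_cong[OF GH, of transpose] G by (simp add: matrix_transpose_mul sym_pos_def_def)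
    then show "transpose H = H"
      by (metis GH matrix_mul_assoc matrix_mul_lid matrix_mul_rid)
    fix v :: "real^'n" assume "v \<noteq> 0"
    then have "H *v v \<noteq> 0" using r[of v] by auto
    then have "(H *v v) \<bullet> (G *v (H *v v)) > 0" using G by (auto simp: sym_pos_def_def)
    then show "v \<bullet> (H *v v) > 0" by (simp add: r inner_commute)
  qed
  then show thesis using l that by blast
qed

lemma uminus_matrix_vector_mult: "(- M) *v v = - (M *v v)" for M :: "real^'n^'m"
  by (simp add: vec_eq_iff matrix_vector_mult_def sum_negf)

section \<open>Weighted norms\<close>

lemma wnorm_zero [simp]: "wnorm M 0 = 0"
  by (simp add: wnorm_def)

lemma wnorm_nonneg: "sym_pos_def M \<Longrightarrow> wnorm M v \<ge> 0"
  by (simp add: wnorm_def sym_pos_def_nonneg)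

lemma wnorm_power2: "sym_pos_def M \<Longrightarrow> (wnorm M v)\<^sup>2 = v \<bullet> (M *v v)"
  by (simp add: wnorm_def sym_pos_def_nonneg)

lemma continuous_on_wnorm [continuous_intros]:
  assumes "continuous_on S f"
  shows "continuous_on S (\<lambda>x. wnorm M (f x))"
  unfolding wnorm_def
  by (intro continuous_intros assms bounded_linear.continuous_on[OF matrix_vector_mul_bounded_linear])

text \<open>The square root is not Lipschitz at zero, so the difference of weighted norms is
  multiplied by their sum: this gives \<open>(u - v) \<bullet> (M *v (u + v))\<close>, where the
  factor \<open>u + v\<close> is controlled by the same sum through coercivity, and the sum
  cancels.\<close>

lemma lipschitz_wnorm:
  fixes M :: "real^'n^'n"
  assumes M: "sym_pos_def M"
  obtains L where "L \<ge> 0" "\<And>u v. \<bar>wnorm M u - wnorm M v\<bar> \<le> L * norm (u - v)"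
proof -
  obtain m where m: "m > 0" "\<And>v. m * (norm v)\<^sup>2 \<le> v \<bullet> (M *v v)"
    using sym_pos_def_coercive[OF M] by blast
  obtain K where K: "K \<ge> 0" "\<And>v. norm (M *v v) \<le> norm v * K"
    using bounded_linear.nonneg_bounded[OF matrix_vector_mul_bounded_linear[of M]] by blast
  have low: "sqrt m * norm v \<le> wnorm M v" for v
    using real_sqrt_le_mono[OF m(2)[of v]] by (simp add: wnorm_def real_sqrt_mult)
  show thesis
  proof (rule that)
    show "K / sqrt m \<ge> 0" using K m by simp
    fix u v
    let ?s = "wnorm M u + wnorm M v"
    show "\<bar>wnorm M u - wnorm M v\<bar> \<le> K / sqrt m * norm (u - v)"
    proof (cases "?s = 0")
      case True
      then have "wnorm M u = 0" "wnorm M v = 0"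
        using wnorm_nonneg[OF M, of u] wnorm_nonneg[OF M, of v] by linarith+
      then show ?thesis using K m by simp
    next
      case False
      then have s: "?s > 0"
        using wnorm_nonneg[OF M, of u] wnorm_nonneg[OF M, of v] by linarith
      have "\<bar>wnorm M u - wnorm M v\<bar> * ?s = \<bar>(wnorm M u)\<^sup>2 - (wnorm M v)\<^sup>2\<bar>"
        using s by (simp add: abs_mult[symmetric] square_diff_square_factored power2_eq_square abs_mult mult.commute)
      also have "\<dots> = \<bar>(u - v) \<bullet> (M *v (u + v))\<bar>"
        using sym_pos_def_inner_commute[OF M, of u v]
        by (simp add: wnorm_power2[OF M] matrix_vector_right_distrib inner_diff_left inner_add_right)
      also have "\<dots> \<le> norm (u - v) * norm (M *v (u + v))" by (rule Cauchy_Schwarz_ineq2)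
      also have "\<dots> \<le> norm (u - v) * ((norm u + norm v) * K)"
        by (intro mult_left_mono order_trans[OF K(2)] mult_right_mono norm_triangle_ineq K(1)) auto
      also have "\<dots> \<le> norm (u - v) * ((?s / sqrt m) * K)"
        using low[of u] low[of v] m K
        by (intro mult_left_mono mult_right_mono) (auto simp: field_simps)
      also have "\<dots> = (K / sqrt m * norm (u - v)) * ?s" by simp
      finally show ?thesis using s by (rule mult_right_le_imp_le)
    qed
  qed
qed

lemma lip_bounded_wnorm:
  fixes g :: "'p \<Rightarrow> 'a::real_normed_vector \<Rightarrow> real^'n"
  assumes M: "sym_pos_def M" and g: "lip_bounded A S g"
  shows "lip_bounded A S (\<lambda>t y. wnorm M (g t y))"
proof -
  obtain L where L: "L \<ge> 0" "\<And>u v. \<bar>wnorm M u - wnorm M v\<bar> \<le> L * norm (u - v)"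
    using lipschitz_wnorm[OF M] by blast
  obtain C where C: "C \<ge> 0" "\<And>t y. t \<in> A \<Longrightarrow> y \<in> S \<Longrightarrow> norm (g t y) \<le> C"
    "\<And>t y z. t \<in> A \<Longrightarrow> y \<in> S \<Longrightarrow> z \<in> S \<Longrightarrow> norm (g t y - g t z) \<le> C * norm (y - z)"
    using lip_boundedE[OF g] by blast
  show ?thesis
  proof (rule lip_boundedI)
    fix t y z assume *: "t \<in> A" "y \<in> S" "z \<in> S"
    show "norm (wnorm M (g t y)) \<le> L * C"
      using L(2)[of "g t y" 0] mult_left_mono[OF C(2)[OF *(1,2)] L(1)] by (simp add: wnorm_def)
    show "norm (wnorm M (g t y) - wnorm M (g t z)) \<le> L * C * norm (y - z)"
      using L(2)[of "g t y" "g t z"] mult_left_mono[OF C(3)[OF *] L(1)] by (simp add: mult.assoc)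
  qed
qed

text \<open>Symmetry merges the two terms of the product rule into the factor 2.\<close>

lemma has_real_derivative_quadratic:
  assumes M: "sym_pos_def M" and e: "(e has_vector_derivative e') (at t within S)"
  shows "((\<lambda>t. e t \<bullet> (M *v e t)) has_real_derivative 2 * (e t \<bullet> (M *v e'))) (at t within S)"
proof -
  have "((\<lambda>t. M *v e t) has_vector_derivative M *v e') (at t within S)"
    by (rule bounded_linear.has_vector_derivative[OF matrix_vector_mul_bounded_linear e])
  from bounded_bilinear.has_vector_derivative[OF bounded_bilinear_inner e this]
  show ?thesis
    using sym_pos_def_inner_commute[OF M, of e' "e t"]
    by (simp add: has_real_derivative_iff_has_vector_derivative)
qed

subsection \<open>The barrier function\<close>

text \<open>
  At \<open>s = 0\<close> the derivative is one-sided: since \<open>sqrt\<close> is odd, the two-sided derivative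
  does not exist there.
\<close>

lemma has_real_derivative_psi_sqrt:
  assumes "0 \<le> s" "sqrt s < c"
  shows "((\<lambda>s. psi c (sqrt s)) has_real_derivative psi' c (sqrt s)) (at s within {0..})"
proof (cases "s = 0")
  case False
  then show ?thesis
    using has_real_derivative_psi[of "sqrt s" c] assms
    by (auto intro: has_field_derivative_at_within)
next
  case True
  have c: "c > 0" using assms True by simp
  \<comment> \<open>At zero the difference quotient equals \<open>1 / (c - sqrt y)\<close>, because
    the square in \<open>psi\<close> undoes the root.\<close>
  have "((\<lambda>y. 1 / (c - sqrt y)) \<longlongrightarrow> 1 / (c - sqrt 0)) (at 0 within {0..})"
    using c by (intro tendsto_intros) auto
  moreover have "\<forall>\<^sub>F y in at 0 within {0..}. 1 / (c - sqrt y) = (psi c (sqrt y) - psi c (sqrt 0)) / (y - 0)"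
    by (auto simp: eventually_at_filter psi_def)
  ultimately have "((\<lambda>y. (psi c (sqrt y) - psi c (sqrt 0)) / (y - 0)) \<longlongrightarrow> 1 / (c - sqrt 0)) (at 0 within {0..})"
    by (rule Lim_transform_eventually)
  moreover have "psi' c 0 = 1 / c"
    using c by (simp add: psi'_def power2_eq_square)
  ultimately show ?thesis using True by (simp add: has_field_derivative_iff)
qed

lemma psi_nonneg: "0 \<le> r \<Longrightarrow> r < c \<Longrightarrow> psi c r \<ge> 0"
  by (simp add: psi_def)

text \<open>The denominator \<open>c - r\<close> is at most \<open>c\<close>. This provides the
  coercivity of \<open>V\<close> in the tracking error.\<close>

lemma power2_le_psi:
  assumes "0 \<le> r" "r < c"
  shows "r\<^sup>2 \<le> c * psi c r"
proof -
  have "r\<^sup>2 * (c - r) \<le> r\<^sup>2 * c" using assms by (intro mult_left_mono) auto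
  then show ?thesis using assms by (simp add: psi_def field_simps)
qed

text \<open>The barrier blows up at \<open>c\<close>, so a sublevel set of it stays a positive
  distance away. The uniform margin \<open>c' < c\<close>, stronger than \<open>r < c\<close>,
  supplies the closed set for the first exit argument.\<close>

lemma psi_barrier:
  assumes "c > 0"
  obtains c' where "0 < c'" "c' < c" "\<And>r. 0 \<le> r \<Longrightarrow> r < c \<Longrightarrow> psi c r \<le> v \<Longrightarrow> r \<le> c'"
proof -
  \<comment> \<open>The first entry forces \<open>r \<ge> c / 2\<close> whenever \<open>r\<close> is
    within \<open>d\<close> of \<open>c\<close>; the second bounds \<open>\<bar>v\<bar> * d\<close>
    by \<open>c\<^sup>2 / 8\<close>, half of what such an \<open>r\<close> would require. The
    summand 1 covers \<open>v = 0\<close>.\<close>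
  define d where "d = min (c / 2) (c\<^sup>2 / (8 * (\<bar>v\<bar> + 1)))"
  have d: "d > 0" "d \<le> c / 2"
    using assms by (simp add: d_def add_nonneg_pos) (simp only: d_def min.cobounded1)
  have "\<bar>v\<bar> * d \<le> (\<bar>v\<bar> + 1) * (c\<^sup>2 / (8 * (\<bar>v\<bar> + 1)))"
    using d by (intro mult_mono) (auto simp: d_def)
  also have "\<dots> = c\<^sup>2 / 8" by (simp add: field_simps)
  finally have vd: "\<bar>v\<bar> * d \<le> c\<^sup>2 / 8" .
  show thesis
  proof (rule that[of "c - d"])
    fix r assume r: "0 \<le> r" "r < c" "psi c r \<le> v"
    show "r \<le> c - d"
    proof (rule ccontr)
      assume "\<not> r \<le> c - d"
      then have n: "c - r < d" "c / 2 \<le> r" using d by auto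
      have "r\<^sup>2 \<le> v * (c - r)" using r by (simp add: psi_def field_simps)
      also have "\<dots> \<le> \<bar>v\<bar> * d" using n r by (intro mult_mono) auto
      also note vd
      finally have "r\<^sup>2 \<le> c\<^sup>2 / 8" .
      moreover have "(c / 2)\<^sup>2 \<le> r\<^sup>2"
        using n assms by (intro power_mono) auto
      moreover have "(c / 2)\<^sup>2 = c\<^sup>2 / 4" by (simp add: power_divide)
      moreover have "c\<^sup>2 > 0" using assms by simp
      ultimately show False by linarith
    qed
  qed (use d assms in auto)
qed

lemma psi'_pos: "0 \<le> r \<Longrightarrow> r < c \<Longrightarrow> psi' c r > 0"
  by (simp add: psi'_def)

text \<open>From 2c - r = c + (c - r). Sums and products of reciprocals are the form to which the
  closure rules of \<open>lip_bounded\<close> apply.\<close>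

lemma psi'_eq:
  assumes "r < c"
  shows "psi' c r = c / 2 * (inverse (c - r) * inverse (c - r)) + 1 / 2 * inverse (c - r)"
proof -
  have "psi' c (c - d) = c / 2 * (inverse d * inverse d) + 1 / 2 * inverse d" if "0 < d" for d
    using that by (simp add: psi'_def field_simps power2_eq_square)
  from this[of "c - r"] show ?thesis using assms by simp
qed

text \<open>Truncation is nonexpansive and keeps the denominator at least \<open>c - c'\<close>,
  away from the singularity of \<open>psi'\<close>.\<close>

lemma lip_bounded_psi':
  assumes "c' < c" and g: "lip_bounded A S g"
  shows "lip_bounded A S (\<lambda>t y. psi' c (min (g t y) c'))"
proof -
  have "lip_bounded A S (\<lambda>t y. min (g t y) c')"
  proof -
    obtain C where C: "C \<ge> 0" "\<And>t y. t \<in> A \<Longrightarrow> y \<in> S \<Longrightarrow> norm (g t y) \<le> C"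
      "\<And>t y z. t \<in> A \<Longrightarrow> y \<in> S \<Longrightarrow> z \<in> S \<Longrightarrow> norm (g t y - g t z) \<le> C * norm (y - z)"
      using lip_boundedE[OF g] by blast
    show ?thesis
    proof (rule lip_boundedI)
      fix t y z assume *: "t \<in> A" "y \<in> S" "z \<in> S"
      show "norm (min (g t y) c') \<le> C + \<bar>c'\<bar>"
        using C(2)[OF *(1,2)] by (simp add: min_def abs_if split: if_splits)
      have "norm (min (g t y) c' - min (g t z) c') \<le> norm (g t y - g t z)"
        by (simp add: min_def abs_if)
      then show "norm (min (g t y) c' - min (g t z) c') \<le> C * norm (y - z)"
        using C(3)[OF *] by linarith
    qed
  qed
  from lip_bounded_add[OF lip_bounded_const lip_bounded_linear[OF bounded_linear_minus[OF bounded_linear_ident] this]]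
  have "lip_bounded A S (\<lambda>t y. c - min (g t y) c')" by simp
  then have inv: "lip_bounded A S (\<lambda>t y. inverse (c - min (g t y) c'))"
    by (rule lip_bounded_inverse[where d = "c - c'"]) (use assms in auto)
  have "psi' c (min (g t y) c') = c / 2 * (inverse (c - min (g t y) c') * inverse (c - min (g t y) c'))
      + 1 / 2 * inverse (c - min (g t y) c')" for t y
    by (rule psi'_eq) (use assms in auto)
  then show ?thesis
    by (simp only:) (intro lip_bounded_add lip_bounded_bilinear[OF bounded_bilinear_mult] lip_bounded_const inv)
qed

lemma continuous_on_psi':
  assumes "continuous_on S g" "\<And>y. y \<in> S \<Longrightarrow> g y < c"
  shows "continuous_on S (\<lambda>y. psi' c (g y))"
  unfolding psi'_def using assms by (intro continuous_intros) fastforce+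

subsection \<open>Adaptive error dynamics\<close>

text \<open>\<open>H\<close> is the inverse of the adaptation gain \<open>G\<close>, carried as a
  parameter because it weights the gain error in \<open>V\<close>.\<close>

locale adaptive_system =
  fixes A P Q G H :: "real^'n^'n" and b :: "real^'n" and \<theta> c :: real
  assumes P: "sym_pos_def P" and Q: "sym_pos_def Q" and H: "sym_pos_def H"
    and lyapunov_eq: "transpose A ** P + P ** A = - Q"
    and HG: "\<And>v. H *v (G *v v) = v"
    and \<theta>_pos: "\<theta> > 0" and c_pos: "c > 0"
begin

text \<open>The scalar gain \<open>\<mu>\<close> is left open so that the true adaptive law and its
  truncation share one definition. The pair is (tracking error, gain error), and
  \<open>fst y + r t\<close> is the actual state.\<close>

definition field :: "(real^'n \<Rightarrow> real) \<Rightarrow> (real \<Rightarrow> real^'n) \<Rightarrow> real \<Rightarrow> (real^'n) \<times> (real^'n) \<Rightarrow> (real^'n) \<times> (real^'n)" where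
  "field \<mu> r t y =
     (A *v fst y + (\<theta> * (snd y \<bullet> (fst y + r t))) *\<^sub>R b,
      - ((\<mu> (fst y) * (fst y \<bullet> (P *v b))) *\<^sub>R (G *v (fst y + r t))))"

abbreviation error_field :: "(real \<Rightarrow> real^'n) \<Rightarrow> real \<Rightarrow> (real^'n) \<times> (real^'n) \<Rightarrow> (real^'n) \<times> (real^'n)" where
  "error_field \<equiv> field (\<lambda>e. psi' c (wnorm P e))"

definition V :: "(real^'n) \<times> (real^'n) \<Rightarrow> real" where
  "V y = psi c (wnorm P (fst y)) + \<theta> * (snd y \<bullet> (H *v snd y))"

text \<open>As quadratic forms the two terms of the Lyapunov equation coincide, because
  \<open>P\<close> is symmetric.\<close>

lemma inner_P_A: "2 * (e \<bullet> (P *v (A *v e))) = - (e \<bullet> (Q *v e))"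
proof -
  have "e \<bullet> ((transpose A ** P + P ** A) *v e) = (A *v e) \<bullet> (P *v e) + e \<bullet> (P *v (A *v e))"
    by (simp add: matrix_vector_mult_add_rdistrib inner_add_right matrix_vector_mul_assoc[symmetric]
        dot_lmul_matrix[symmetric] inner_commute del: transpose_matrix_vector)
  also have "\<dots> = 2 * (e \<bullet> (P *v (A *v e)))"
    using sym_pos_def_inner_commute[OF P, of "A *v e" e] by simp
  finally show ?thesis
    unfolding lyapunov_eq uminus_matrix_vector_mult by simp
qed

text \<open>Because \<open>psi'\<close> differentiates with respect to the squared norm, the barrier
  part contributes \<open>psi'\<close> times the cross term
  \<open>2 * \<theta> * (k \<bullet> x) * (e \<bullet> (P *v b))\<close>. The gain part contributes
  its exact negative, since \<open>H\<close> cancels \<open>G\<close>. Only the \<open>Q\<close>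
  term is left.\<close>

lemma has_real_derivative_V:
  assumes y: "(y has_vector_derivative error_field r t (y t)) (at t within S)"
    and lt: "wnorm P (fst (y t)) < c"
  shows "((\<lambda>t. V (y t)) has_real_derivative
    - (psi' c (wnorm P (fst (y t))) * (fst (y t) \<bullet> (Q *v fst (y t))))) (at t within S)"
proof -
  let ?e = "\<lambda>t. fst (y t)" and ?k = "\<lambda>t. snd (y t)"
  let ?x = "?e t + r t" and ?m = "psi' c (wnorm P (?e t))"
  let ?de = "A *v ?e t + (\<theta> * (?k t \<bullet> ?x)) *\<^sub>R b"
  let ?dk = "- ((?m * (?e t \<bullet> (P *v b))) *\<^sub>R (G *v ?x))"
  let ?q = "\<lambda>t. ?e t \<bullet> (P *v ?e t)"
  have de: "(?e has_vector_derivative ?de) (at t within S)"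
    using bounded_linear.has_vector_derivative[OF bounded_linear_fst y] by (simp add: field_def)
  have dk: "(?k has_vector_derivative ?dk) (at t within S)"
    using bounded_linear.has_vector_derivative[OF bounded_linear_snd y] by (simp add: field_def)
  have dq: "(?q has_real_derivative 2 * (?e t \<bullet> (P *v ?de))) (at t within S)"
    by (rule has_real_derivative_quadratic[OF P de])
  \<comment> \<open>The quadratic form takes only nonnegative values, so the derivative of
    \<open>psi\<close> of the root within \<open>{0..}\<close> is enough for the chain rule, also
    when the tracking error vanishes.\<close>
  have "((\<lambda>s. psi c (sqrt s)) has_real_derivative ?m) (at (?q t) within ?q ` S)"
    using has_real_derivative_psi_sqrt[OF sym_pos_def_nonneg[OF P, of "?e t"]] lt
    by (auto simp: wnorm_def intro: has_field_derivative_subset sym_pos_def_nonneg[OF P])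
  from DERIV_image_chain[OF this dq]
  have d1: "((\<lambda>t. psi c (wnorm P (?e t))) has_real_derivative ?m * (2 * (?e t \<bullet> (P *v ?de)))) (at t within S)"
    by (simp add: o_def wnorm_def)
  have "((\<lambda>t. V (y t)) has_real_derivative
      ?m * (2 * (?e t \<bullet> (P *v ?de))) + \<theta> * (2 * (?k t \<bullet> (H *v ?dk)))) (at t within S)"
    unfolding V_def
    by (intro DERIV_add d1 DERIV_cmult has_real_derivative_quadratic[OF H dk])
  moreover have "H *v ?dk = - ((?m * (?e t \<bullet> (P *v b))) *\<^sub>R ?x)"
    by (simp add: linear_neg[OF matrix_vector_mul_linear] matrix_vector_mult_scaleR HG)
  moreover have "2 * (?e t \<bullet> (P *v ?de)) = - (?e t \<bullet> (Q *v ?e t)) + 2 * \<theta> * (?k t \<bullet> ?x) * (?e t \<bullet> (P *v b))"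
    using inner_P_A[of "?e t"]
    by (simp add: matrix_vector_right_distrib matrix_vector_mult_scaleR inner_add_right)
  ultimately show ?thesis
    by (simp only:) (simp add: algebra_simps inner_commute)
qed

text \<open>The decrease is conditional on the barrier being respected up to time \<open>t\<close>;
  the first exit argument removes this condition.\<close>

lemma V_antimono:
  assumes y: "ode_sol (error_field r) {t0..t} y" and "t0 \<le> t"
    and lt: "\<And>s. s \<in> {t0..t} \<Longrightarrow> wnorm P (fst (y s)) < c"
  shows "V (y t) \<le> V (y t0)"
proof (rule DERIV_nonpos_imp_decreasing_open[OF \<open>t0 \<le> t\<close>])
  let ?D = "\<lambda>s. - (psi' c (wnorm P (fst (y s))) * (fst (y s) \<bullet> (Q *v fst (y s))))"
  have D: "((\<lambda>t. V (y t)) has_real_derivative ?D s) (at s within {t0..t})" if "s \<in> {t0..t}" for s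
    using y lt that unfolding ode_sol_def by (intro has_real_derivative_V) auto
  then show "continuous_on {t0..t} (\<lambda>t. V (y t))"
    by (rule DERIV_continuous_on)
  fix s assume s: "t0 < s" "s < t"
  then have "at s within {t0..t} = at s" by (intro at_within_interior) auto
  moreover have "?D s \<le> 0"
    using psi'_pos[OF wnorm_nonneg[OF P] lt, of s] s sym_pos_def_nonneg[OF Q, of "fst (y s)"] by simp
  ultimately show "\<exists>D. ((\<lambda>t. V (y t)) has_real_derivative D) (at s) \<and> D \<le> 0"
    using D[of s] s by auto
qed

lemma psi_le_V: "psi c (wnorm P (fst y)) \<le> V y"
  using \<theta>_pos sym_pos_def_nonneg[OF H, of "snd y"] by (simp add: V_def)

lemma V_coercive:
  obtains D where "D > 0" "\<And>y. wnorm P (fst y) < c \<Longrightarrow> (norm y)\<^sup>2 \<le> D * V y"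
proof -
  obtain p where p: "p > 0" "\<And>v. p * (norm v)\<^sup>2 \<le> v \<bullet> (P *v v)"
    using sym_pos_def_coercive[OF P] by blast
  obtain q where q: "q > 0" "\<And>v. q * (norm v)\<^sup>2 \<le> v \<bullet> (H *v v)"
    using sym_pos_def_coercive[OF H] by blast
  show thesis
  proof (rule that)
    \<comment> \<open>The sum of the separate constants for tracking error and gain error serves
      both at once, as both parts of \<open>V\<close> are nonnegative.\<close>
    let ?D = "c / p + 1 / (\<theta> * q)"
    show "?D > 0" using p q c_pos \<theta>_pos by (simp add: add_pos_pos)
    fix y :: "(real^'n) \<times> (real^'n)" assume lt: "wnorm P (fst y) < c"
    have "p * (norm (fst y))\<^sup>2 \<le> c * psi c (wnorm P (fst y))"
      using p(2)[of "fst y"] power2_le_psi[OF wnorm_nonneg[OF P] lt] wnorm_power2[OF P, of "fst y"] by simp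
    then have 1: "(norm (fst y))\<^sup>2 \<le> c / p * psi c (wnorm P (fst y))"
      using p(1) by (simp add: field_simps)
    have "q * (norm (snd y))\<^sup>2 * \<theta> \<le> \<theta> * (snd y \<bullet> (H *v snd y))"
      using q(2)[of "snd y"] \<theta>_pos by simp
    then have 2: "(norm (snd y))\<^sup>2 \<le> 1 / (\<theta> * q) * (\<theta> * (snd y \<bullet> (H *v snd y)))"
      using q(1) \<theta>_pos by (simp add: field_simps)
    let ?a = "psi c (wnorm P (fst y))" and ?b = "\<theta> * (snd y \<bullet> (H *v snd y))"
    have ab: "?a \<ge> 0" "?b \<ge> 0"
      using psi_nonneg[OF wnorm_nonneg[OF P] lt] \<theta>_pos sym_pos_def_nonneg[OF H, of "snd y"] by auto
    have "c / p * ?a + 1 / (\<theta> * q) * ?b \<le> ?D * ?a + ?D * ?b"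
      using ab p q c_pos \<theta>_pos by (intro add_mono mult_right_mono) auto
    moreover have "(norm y)\<^sup>2 = (norm (fst y))\<^sup>2 + (norm (snd y))\<^sup>2"
      by (simp add: norm_prod_def)
    moreover have "?D * ?a + ?D * ?b = ?D * V y"
      by (simp only: V_def distrib_left)
    ultimately show "(norm y)\<^sup>2 \<le> ?D * V y" using 1 2 by linarith
  qed
qed

text \<open>While the weighted norm is below \<open>c\<close>, \<open>V\<close> does not exceed its
  initial value, and \<open>psi_barrier\<close> then pushes the norm down to some
  \<open>c' < c\<close>. This is the first exit argument with the open set below \<open>c\<close>
  and the closed set up to \<open>c'\<close>; it applies to a solution on any forward
  interval.\<close>

lemma barrier_invariance:
  assumes I: "forward_interval t0 I" and y: "ode_sol (error_field r) I y"
    and lt: "wnorm P (fst (y t0)) < c" and t: "t \<in> I"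
  shows "wnorm P (fst (y t)) < c" and "V (y t) \<le> V (y t0)"
proof -
  obtain c' where c': "0 < c'" "c' < c" "\<And>r. 0 \<le> r \<Longrightarrow> r < c \<Longrightarrow> psi c r \<le> V (y t0) \<Longrightarrow> r \<le> c'"
    using psi_barrier[OF c_pos, of "V (y t0)"] by blast
  have V_le: "V (y s) \<le> V (y t0)" if "s \<in> I" "\<And>q. q \<in> {t0..s} \<Longrightarrow> wnorm P (fst (y q)) < c" for s
    using V_antimono[OF ode_sol_subset[OF y forward_interval_segment[OF I that(1)]]] that I
    by (auto simp: forward_interval_def)
  have inv: "\<forall>s\<in>I. wnorm P (fst (y s)) \<in> {..c'}"
  proof (rule first_exit_invariance[OF I, where U = "{..<c}"])
    show "continuous_on I (\<lambda>s. wnorm P (fst (y s)))"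
      by (intro continuous_intros ode_sol_imp_continuous_on[OF y])
    fix s assume s: "s \<in> I" "\<And>q. q \<in> {t0..s} \<Longrightarrow> wnorm P (fst (y q)) \<in> {..<c}"
    have "t0 \<le> s" using I s(1) by (auto simp: forward_interval_def)
    with s V_le[of s] psi_le_V[of "y s"] show "wnorm P (fst (y s)) \<in> {..c'}"
      using c'(3)[OF wnorm_nonneg[OF P]] by fastforce
  qed (use c' lt in auto)
  then show "wnorm P (fst (y t)) < c" using t c'(2) by fastforce
  show "V (y t) \<le> V (y t0)"
    using inv c'(2) forward_interval_segment[OF I t] by (intro V_le t) fastforce
qed

lemma lip_bounded_field:
  assumes r: "bounded (r ` T)" and S: "bounded S" and "c' < c"
  shows "lip_bounded T S (field (\<lambda>e. psi' c (min (wnorm P e) c')) r)"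
proof -
  have f: "lip_bounded T S (\<lambda>t y. fst y)" and s: "lip_bounded T S (\<lambda>t y. snd y)"
    by (intro lip_bounded_linear[OF bounded_linear_fst] lip_bounded_linear[OF bounded_linear_snd]
        lip_bounded_id[OF S])+
  have x: "lip_bounded T S (\<lambda>t y. fst y + r t)"
    by (intro lip_bounded_add f lip_bounded_param r)
  note lin = lip_bounded_linear[OF matrix_vector_mul_bounded_linear]
  have "lip_bounded T S (\<lambda>t y. A *v fst y + (\<theta> * (snd y \<bullet> (fst y + r t))) *\<^sub>R b)"
    by (intro lip_bounded_add lin f lip_bounded_bilinear[OF bounded_bilinear_scaleR]
        lip_bounded_bilinear[OF bounded_bilinear_mult] lip_bounded_bilinear[OF bounded_bilinear_inner]
        lip_bounded_const s x)
  \<comment> \<open>The pair is assembled as a sum of the two linear injections into the product;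
    the second one absorbs the minus sign of the adaptive law.\<close>
  note 1 = lip_bounded_linear[OF bounded_linear_Pair[OF bounded_linear_ident bounded_linear_zero] this]
  have "lip_bounded T S (\<lambda>t y. (psi' c (min (wnorm P (fst y)) c') * (fst y \<bullet> (P *v b))) *\<^sub>R (G *v (fst y + r t)))"
    by (intro lin f lip_bounded_bilinear[OF bounded_bilinear_scaleR]
        lip_bounded_bilinear[OF bounded_bilinear_mult] lip_bounded_bilinear[OF bounded_bilinear_inner]
        lip_bounded_const x lip_bounded_psi' lip_bounded_wnorm P \<open>c' < c\<close>)
  note 2 = lip_bounded_linear[OF bounded_linear_Pair[OF bounded_linear_zero bounded_linear_minus[OF bounded_linear_ident]] this]
  show ?thesis
    using lip_bounded_add[OF 1 2] by (simp add: field_def[abs_def])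
qed

text \<open>
  The vector field is made globally Lipschitz by truncating \<open>psi'\<close> below the barrier and projecting
  the state onto a large ball; the Lyapunov function keeps the solution where nothing was changed.
\<close>

lemma global_solution:
  assumes r: "continuous_on {t0..} r" and lt: "wnorm P (fst y0) < c"
  shows "\<exists>y. ode_sol (error_field r) {t0..} y \<and> y t0 = y0"
proof -
  obtain c' where c': "0 < c'" "c' < c" "\<And>r. 0 \<le> r \<Longrightarrow> r < c \<Longrightarrow> psi c r \<le> V y0 \<Longrightarrow> r \<le> c'"
    using psi_barrier[OF c_pos, of "V y0"] by blast
  obtain D where D: "D > 0" "\<And>y. wnorm P (fst y) < c \<Longrightarrow> (norm y)\<^sup>2 \<le> D * V y"
    using V_coercive by blast
  \<comment> \<open>The truncation level lies strictly between: above \<open>c'\<close>, so that the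
    solution never feels it, and below \<open>c\<close>, so that the truncated \<open>psi'\<close>
    is Lipschitz.\<close>
  define d where "d = (c' + c) / 2"
  have d: "c' < d" "d < c" using c' by (auto simp: d_def)
  define R where "R = sqrt (D * V y0)"
  have R: "norm y \<le> R" if "wnorm P (fst y) < c" "V y \<le> V y0" for y
  proof -
    have "(norm y)\<^sup>2 \<le> D * V y0"
      using D(2)[OF that(1)] mult_left_mono[OF that(2), of D] D(1) by linarith
    then show ?thesis unfolding R_def by (rule real_le_rsqrt)
  qed
  have R0: "R \<ge> 0" using R[OF lt] norm_ge_zero order_trans by blast
  \<comment> \<open>\<open>R\<close> bounds every state whose \<open>V\<close> is at most the
    initial value; the extra 1 leaves an open neighbourhood on which the projection is the
    identity.\<close>
  define B :: "((real^'n) \<times> (real^'n)) set" where "B = cball 0 (R + 1)"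
  have B: "closed B" "convex B" "B \<noteq> {}" "bounded B" using R0 by (auto simp: B_def)
  define g where "g = field (\<lambda>e. psi' c (min (wnorm P e) d)) r"
  have g_eq: "g t y = error_field r t y" if "wnorm P (fst y) \<le> d" for t y
    using that by (simp add: g_def field_def min_def)
  \<comment> \<open>Projection onto a closed convex set is nonexpansive, so \<open>F\<close>
    inherits globally the Lipschitz constant that \<open>g\<close> has on \<open>B\<close>.\<close>
  define F where "F t y = g t (closest_point B y)" for t y
  have cB: "continuous_on S (closest_point B)" for S
    by (rule continuous_on_closest_point[OF B(2,1,3)])
  have "\<exists>y. ode_sol F {t0..} y \<and> y t0 = y0"
  proof (rule global_ode_solution)
    have "continuous_on ({t0..} \<times> UNIV) (\<lambda>(t, y). g t y)"
      unfolding g_def field_def split_def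
      by (intro continuous_intros continuous_on_psi' continuous_on_compose2[OF r]
          bounded_linear.continuous_on[OF matrix_vector_mul_bounded_linear])
         (use d in \<open>auto simp: min_def\<close>)
    moreover have "continuous_on ({t0..} \<times> UNIV) (\<lambda>p. (fst p, closest_point B (snd p)))"
      by (intro continuous_intros continuous_on_compose2[OF cB[of UNIV]]) auto
    ultimately have "continuous_on ({t0..} \<times> UNIV) (\<lambda>p. (\<lambda>(t, y). g t y) (fst p, closest_point B (snd p)))"
      by (rule continuous_on_compose2) auto
    then show "continuous_on ({t0..} \<times> UNIV) (\<lambda>(t, y). F t y)"
      by (simp add: F_def split_def)
    fix T
    have "bounded (r ` {t0..T})"
      by (intro compact_imp_bounded compact_continuous_image continuous_on_subset[OF r]) auto
    then have "lip_bounded {t0..T} B g"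
      unfolding g_def by (rule lip_bounded_field[OF _ B(4) d(2)])
    then obtain C where C: "C \<ge> 0" "\<And>t y. t \<in> {t0..T} \<Longrightarrow> y \<in> B \<Longrightarrow> norm (g t y) \<le> C"
      "\<And>t y z. t \<in> {t0..T} \<Longrightarrow> y \<in> B \<Longrightarrow> z \<in> B \<Longrightarrow> norm (g t y - g t z) \<le> C * norm (y - z)"
      using lip_boundedE by blast
    show "\<exists>L\<ge>0. \<forall>t\<in>{t0..T}. \<forall>y z. norm (F t y - F t z) \<le> L * norm (y - z)"
    proof (intro exI[of _ C] conjI C ballI allI)
      fix t y z assume t: "t \<in> {t0..T}"
      have "norm (F t y - F t z) \<le> C * norm (closest_point B y - closest_point B z)"
        unfolding F_def by (intro C(3) t closest_point_in_set B)
      also have "\<dots> \<le> C * norm (y - z)"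
        using closest_point_lipschitz[OF B(2,1,3), of y z] C(1)
        by (intro mult_left_mono) (auto simp: dist_norm)
      finally show "norm (F t y - F t z) \<le> C * norm (y - z)" .
    qed
  qed
  then obtain y where y: "ode_sol F {t0..} y" "y t0 = y0" by blast
  have F_eq: "F t z = error_field r t z" if "wnorm P (fst z) < d" "norm z < R + 1" for t z
    using that g_eq by (simp add: F_def closest_point_self B_def)
  \<comment> \<open>Inside the open set \<open>F\<close> is the true field, so \<open>V\<close>
    decreases, which confines the state to the smaller closed set; hence the modified and the true
    equation agree along the solution.\<close>
  have "\<forall>t\<in>{t0..}. y t \<in> {z. wnorm P (fst z) \<le> c'} \<inter> cball 0 R"
  proof (rule first_exit_invariance[where U = "{z. wnorm P (fst z) < d} \<inter> ball 0 (R + 1)"])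
    show "forward_interval t0 {t0..}" by (simp add: forward_interval_def is_interval_1)
    show "continuous_on {t0..} y" by (rule ode_sol_imp_continuous_on[OF y(1)])
    show "closed ({z. wnorm P (fst z) \<le> c'} \<inter> cball 0 R)"
      by (intro closed_Int closed_Collect_le closed_cball continuous_intros)
    show "open ({z. wnorm P (fst z) < d} \<inter> ball 0 (R + 1))"
      by (intro open_Int open_Collect_less open_ball continuous_intros)
    show "y t0 \<in> {z. wnorm P (fst z) < d} \<inter> ball 0 (R + 1)"
      using c'(3)[OF wnorm_nonneg[OF P] lt psi_le_V] R[OF lt] d y(2) by auto
    show "{z. wnorm P (fst z) \<le> c'} \<inter> cball 0 R \<subseteq> {z. wnorm P (fst z) < d} \<inter> ball 0 (R + 1)"
      using d by auto
    fix t assume t: "t \<in> {t0..}"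
      and U: "\<And>s. s \<in> {t0..t} \<Longrightarrow> y s \<in> {z. wnorm P (fst z) < d} \<inter> ball 0 (R + 1)"
    have "ode_sol F {t0..t} y" using y(1) by (rule ode_sol_subset) auto
    then have sol: "ode_sol (error_field r) {t0..t} y"
      by (rule ode_sol_cong) (use U F_eq in auto)
    have *: "wnorm P (fst (y s)) < c" if "s \<in> {t0..t}" for s
      using U[OF that] d by auto
    have V: "V (y t) \<le> V y0"
      using V_antimono[OF sol _ *] t y(2) by auto
    have "wnorm P (fst (y t)) < c" using * t by auto
    then show "y t \<in> {z. wnorm P (fst z) \<le> c'} \<inter> cball 0 R"
      using R[OF _ V] c'(3)[OF wnorm_nonneg[OF P] _ order_trans[OF psi_le_V V]] by simp
  qed
  then have "wnorm P (fst (y t)) < d \<and> norm (y t) < R + 1" if "t \<in> {t0..}" for t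
    using d(1) that by force
  then have "ode_sol (error_field r) {t0..} y"
    by (intro ode_sol_cong[OF y(1)] F_eq) auto
  then show ?thesis using y(2) by blast
qed

text \<open>Continuity of \<open>V\<close> at the origin makes it small initially, monotonicity
  keeps it small, and coercivity turns this into a bound on the norm. Of the reference trajectory
  only continuity enters.\<close>

lemma stable:
  assumes r: "continuous_on {0..} r"
  shows "lyapunov_stable_origin (error_field r)"
  unfolding lyapunov_stable_origin_def
proof (intro conjI allI impI)
  show "error_field r t 0 = 0" for t
    by (simp add: field_def zero_prod_def)
next
  fix t0 \<epsilon> :: real assume t0: "t0 \<ge> 0" and \<epsilon>: "\<epsilon> > 0"
  obtain D where D: "D > 0" "\<And>y. wnorm P (fst y) < c \<Longrightarrow> (norm y)\<^sup>2 \<le> D * V y"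
    using V_coercive by blast
  have w: "isCont (\<lambda>y::(real^'n) \<times> (real^'n). wnorm P (fst y)) 0"
    by (rule continuous_on_interior[of UNIV]) (auto intro!: continuous_intros)
  have q: "isCont (\<lambda>y::(real^'n) \<times> (real^'n). snd y \<bullet> (H *v snd y)) 0"
    by (rule continuous_on_interior[of UNIV])
       (auto intro!: continuous_intros bounded_linear.continuous_on[OF matrix_vector_mul_bounded_linear])
  have w0: "wnorm P (fst (0 :: (real^'n) \<times> (real^'n))) = 0" by (simp add: wnorm_def)
  have "isCont V 0"
    unfolding V_def psi_def using w0 c_pos by (intro continuous_intros w q) auto
  moreover have "V 0 = 0" by (simp add: V_def psi_def w0)
  \<comment> \<open>The level is chosen so that \<open>D * V y\<close> stays below
    \<open>\<epsilon>\<^sup>2\<close>. Intersecting with the region inside the barrier makes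
    existence and invariance available for the same initial states.\<close>
  ultimately have "\<forall>\<^sub>F y in nhds 0. V y < \<epsilon>\<^sup>2 / D"
    unfolding isCont_def tendsto_at_iff_tendsto_nhds using order_tendstoD(2)[of V 0 "nhds 0" "\<epsilon>\<^sup>2 / D"] \<epsilon> D(1) by simp
  moreover have "\<forall>\<^sub>F y in nhds (0 :: (real^'n) \<times> (real^'n)). wnorm P (fst y) < c"
    by (rule order_tendstoD(2)[OF tendsto_at_iff_tendsto_nhds[THEN iffD1, OF w[unfolded isCont_def]]])
       (simp add: w0 c_pos)
  ultimately have "\<forall>\<^sub>F y in nhds 0. V y < \<epsilon>\<^sup>2 / D \<and> wnorm P (fst y) < c"
    by (rule eventually_conj)
  then obtain \<delta> where \<delta>: "\<delta> > 0" "\<And>y. norm y < \<delta> \<Longrightarrow> V y < \<epsilon>\<^sup>2 / D \<and> wnorm P (fst y) < c"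
    unfolding eventually_nhds_metric by (auto simp: dist_norm)
  show "\<exists>\<delta>>0. \<forall>y0. norm y0 < \<delta> \<longrightarrow>
        (\<exists>y. ode_sol (error_field r) {t0..} y \<and> y t0 = y0) \<and>
        (\<forall>I y. forward_interval t0 I \<and> ode_sol (error_field r) I y \<and> y t0 = y0 \<longrightarrow>
               (\<forall>t\<in>I. norm (y t) < \<epsilon>))"
  proof (intro exI[of _ \<delta>] conjI \<delta>(1) allI impI ballI)
    fix y0 :: "(real^'n) \<times> (real^'n)" assume "norm y0 < \<delta>"
    note y0 = \<delta>(2)[OF this]
    show "\<exists>y. ode_sol (error_field r) {t0..} y \<and> y t0 = y0"
      using t0 y0 by (intro global_solution continuous_on_subset[OF r]) auto
    fix I y t assume "forward_interval t0 I \<and> ode_sol (error_field r) I y \<and> y t0 = y0" and t: "t \<in> I"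
    then have *: "forward_interval t0 I" "ode_sol (error_field r) I y" "wnorm P (fst (y t0)) < c" "y t0 = y0"
      using y0 by auto
    have "(norm (y t))\<^sup>2 \<le> D * V (y t)"
      by (rule D(2)[OF barrier_invariance(1)[OF *(1-3) t]])
    also have "\<dots> \<le> D * V y0"
      using barrier_invariance(2)[OF *(1-3) t] D(1) *(4) by simp
    also have "\<dots> < \<epsilon>\<^sup>2" using y0 D(1) by (simp add: field_simps)
    finally show "norm (y t) < \<epsilon>" using \<epsilon> by (simp add: power_less_imp_less_base)
  qed
qed

end

subsection \<open>The platoon\<close>

text \<open>The forcing cancels in differences, so an operator bound of \<open>A\<close> is a
  Lipschitz constant. This yields the reference trajectory.\<close>

lemma linear_system_solution:
  fixes A :: "real^'n^'n" and g :: "real \<Rightarrow> real^'n"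
  assumes g: "continuous_on {t0..} g"
  shows "\<exists>z. ode_sol (\<lambda>t \<xi>. A *v \<xi> + g t) {t0..} z \<and> z t0 = z0"
proof (rule global_ode_solution)
  have "continuous_on ({t0..} \<times> UNIV) (\<lambda>p. A *v snd p + g (fst p))"
    by (intro continuous_intros bounded_linear.continuous_on[OF matrix_vector_mul_bounded_linear]
        continuous_on_compose2[OF g]) auto
  then show "continuous_on ({t0..} \<times> UNIV) (\<lambda>(t, \<xi>). A *v \<xi> + g t)"
    by (simp add: split_def)
  obtain K where "K \<ge> 0" "\<And>v. norm (A *v v) \<le> norm v * K"
    using bounded_linear.nonneg_bounded[OF matrix_vector_mul_bounded_linear[of A]] by blast
  then show "\<exists>L\<ge>0. \<forall>t\<in>{t0..T}. \<forall>y z. norm (A *v y + g t - (A *v z + g t)) \<le> L * norm (y - z)" for T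
    by (auto simp: matrix_vector_mult_diff_distrib[symmetric] mult.commute)
qed

lemma adaptive_system_vehicle:
  assumes "T > 0" "L > 0" "c > 0" "sym_pos_def \<Gamma>" "sym_pos_def P" "sym_pos_def Q"
    and "transpose (Am_mat h kp kd \<tau>b) ** P + P ** Am_mat h kp kd \<tau>b = - Q"
  obtains H where "adaptive_system (Am_mat h kp kd \<tau>b) P Q \<Gamma> H (L / T) c"
    "error_dynamics h kp kd \<tau>b c P T L \<Gamma> = adaptive_system.field (Am_mat h kp kd \<tau>b) P \<Gamma> Bu_vec (L / T)
      (\<lambda>e. psi' c (wnorm P e))"
proof -
  obtain H where "sym_pos_def H" "\<And>v. H *v (\<Gamma> *v v) = v"
    using sym_pos_def_inverse[OF assms(4)] by blast
  then have *: "adaptive_system (Am_mat h kp kd \<tau>b) P Q \<Gamma> H (L / T) c"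
    using assms by unfold_locales auto
  show thesis
    by (rule that[OF *])
       (simp add: fun_eq_iff error_dynamics_def adapt_law_def split_def adaptive_system.field_def[OF *])
qed

text \<open>Given the predecessor's signal, the reference vehicle is not influenced by the actual
  one and is solved first. The error dynamics along it are solved next, and the actual state and
  gain are recovered by adding back \<open>xr\<close> and \<open>kx_vec\<close>.\<close>

lemma vehicle_solution:
  fixes w :: "real \<Rightarrow> real^2"
  assumes pos: "T > 0" "L > 0" "\<tau>b > 0" and "c > 0" "sym_pos_def \<Gamma>" "sym_pos_def P" "sym_pos_def Q"
    and "transpose (Am_mat h kp kd \<tau>b) ** P + P ** Am_mat h kp kd \<tau>b = - Q"
    and w: "continuous_on {0..} w" and lt: "wnorm P (x0 - xr0) < c"
  shows "\<exists>x xr k.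
    ode_sol (\<lambda>t \<xi>. A_mat h kp kd T L *v \<xi> + Bw_mat h kd *v w t + (L / T * (k t \<bullet> \<xi>)) *\<^sub>R Bu_vec) {0..} x \<and>
    ode_sol (\<lambda>t \<xi>. Am_mat h kp kd \<tau>b *v \<xi> + Bw_mat h kd *v w t) {0..} xr \<and>
    ode_sol (\<lambda>t \<kappa>. adapt_law c P \<Gamma> (x t) (x t - xr t)) {0..} k \<and>
    x 0 = x0 \<and> xr 0 = xr0 \<and> k 0 = k0"
proof -
  obtain H where sys: "adaptive_system (Am_mat h kp kd \<tau>b) P Q \<Gamma> H (L / T) c"
    and err: "error_dynamics h kp kd \<tau>b c P T L \<Gamma> = adaptive_system.field (Am_mat h kp kd \<tau>b) P \<Gamma> Bu_vec (L / T)
      (\<lambda>e. psi' c (wnorm P e))"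
    using adaptive_system_vehicle assms by metis
  have "continuous_on {0..} (\<lambda>t. Bw_mat h kd *v w t)"
    by (intro bounded_linear.continuous_on[OF matrix_vector_mul_bounded_linear] w)
  from linear_system_solution[OF this] obtain xr where
    xr: "ode_sol (\<lambda>t \<xi>. Am_mat h kp kd \<tau>b *v \<xi> + Bw_mat h kd *v w t) {0..} xr" "xr 0 = xr0" by blast
  let ?k = "kx_vec \<tau>b T L"
  obtain y where y: "ode_sol (error_dynamics h kp kd \<tau>b c P T L \<Gamma> xr) {0..} y" "y 0 = (x0 - xr0, k0 - ?k)"
    using adaptive_system.global_solution[OF sys ode_sol_imp_continuous_on[OF xr(1)], of "(x0 - xr0, k0 - ?k)"] lt
    unfolding err by auto
  define x where "x t = fst (y t) + xr t" for t
  define k where "k t = snd (y t) + ?k" for t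
  have dx: "(x has_vector_derivative A_mat h kp kd T L *v x t + Bw_mat h kd *v w t
      + (L / T * (k t \<bullet> x t)) *\<^sub>R Bu_vec) (at t within {0..})"
    and dk: "(k has_vector_derivative adapt_law c P \<Gamma> (x t) (x t - xr t)) (at t within {0..})"
    if t: "t \<in> {0..}" for t
  proof -
    have dy: "(y has_vector_derivative error_dynamics h kp kd \<tau>b c P T L \<Gamma> xr t (y t)) (at t within {0..})"
      and dr: "(xr has_vector_derivative Am_mat h kp kd \<tau>b *v xr t + Bw_mat h kd *v w t) (at t within {0..})"
      using y(1) xr(1) t unfolding ode_sol_def by blast+
    have "Am_mat h kp kd \<tau>b *v fst (y t) + (L / T * (snd (y t) \<bullet> x t)) *\<^sub>R Bu_vec
        + (Am_mat h kp kd \<tau>b *v xr t + Bw_mat h kd *v w t)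
        = Am_mat h kp kd \<tau>b *v x t + Bw_mat h kd *v w t + (L / T * (snd (y t) \<bullet> x t)) *\<^sub>R Bu_vec"
      by (simp add: x_def matrix_vector_right_distrib)
    \<comment> \<open>The matching condition trades \<open>Am_mat\<close> for \<open>A_mat\<close>
      plus an input with the ideal gain, which turns the gain error into the full gain
      \<open>k\<close>.\<close>
    also have "\<dots> = A_mat h kp kd T L *v x t + Bw_mat h kd *v w t + (L / T * (k t \<bullet> x t)) *\<^sub>R Bu_vec"
      by (simp add: matching_condition[OF pos] k_def inner_add_left distrib_left scaleR_left_distrib)
    finally have eq: "fst (error_dynamics h kp kd \<tau>b c P T L \<Gamma> xr t (y t)) + (Am_mat h kp kd \<tau>b *v xr t + Bw_mat h kd *v w t)
        = A_mat h kp kd T L *v x t + Bw_mat h kd *v w t + (L / T * (k t \<bullet> x t)) *\<^sub>R Bu_vec"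
      by (simp add: error_dynamics_def split_def x_def)
    show "(x has_vector_derivative A_mat h kp kd T L *v x t + Bw_mat h kd *v w t
      + (L / T * (k t \<bullet> x t)) *\<^sub>R Bu_vec) (at t within {0..})"
      using has_vector_derivative_add[OF bounded_linear.has_vector_derivative[OF bounded_linear_fst dy] dr]
      unfolding eq x_def[abs_def] .
    show "(k has_vector_derivative adapt_law c P \<Gamma> (x t) (x t - xr t)) (at t within {0..})"
      using has_vector_derivative_add[OF bounded_linear.has_vector_derivative[OF bounded_linear_snd dy]
          has_vector_derivative_const[of ?k]]
      by (simp add: error_dynamics_def split_def x_def k_def[abs_def])
  qed
  have "x 0 = x0" "k 0 = k0" using y(2) xr(2) by (simp_all add: x_def k_def)
  then show ?thesis using dx dk xr unfolding ode_sol_def by blast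
qed

text \<open>Vehicle \<open>j\<close> looks only at itself and at \<open>j - 1\<close>, which is
  again in range unless it is the leader; so a platoon can be extended without disturbing the
  vehicles already solved.\<close>

lemma closed_loop_cong:
  assumes cl: "closed_loop N h kp kd \<tau>b c P \<tau> \<Lambda> \<Gamma> v0 u0 I x xr k"
    and eq: "\<And>j. j \<in> {1..N} \<Longrightarrow> x' j = x j \<and> xr' j = xr j \<and> k' j = k j"
  shows "closed_loop N h kp kd \<tau>b c P \<tau> \<Lambda> \<Gamma> v0 u0 I x' xr' k'"
proof -
  have w: "w_prev v0 u0 x' j = w_prev v0 u0 x j" if "j \<in> {1..N}" for j
  proof (cases "j = 1")
    case False
    then have "j - 1 \<in> {1..N}" using that by auto
    then show ?thesis using eq[of "j - 1"] by (simp add: fun_eq_iff w_prev_def)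
  qed (simp add: fun_eq_iff w_prev_def)
  show ?thesis
    using cl by (simp only: closed_loop_def w eq Ball_def) (simp add: w eq)
qed

lemma continuous_on_vector_2:
  fixes f g :: "'a::topological_space \<Rightarrow> real"
  assumes "continuous_on S f" "continuous_on S g"
  shows "continuous_on S (\<lambda>t. vector [f t, g t] :: real^2)"
proof -
  have "(vector [f t, g t] :: real^2) = (\<chi> i. if i = 1 then f t else g t)" for t
    by (simp add: vec_eq_iff forall_2)
  moreover have "continuous_on S (\<lambda>t. if i = 1 then f t else g t)" for i :: 2
    using assms by (cases "i = 1") simp_all
  ultimately show ?thesis
    by (simp only:) (intro continuous_on_vec_lambda)
qed

text \<open>Coupling runs only from front to back, so induction on \<open>N\<close> appends one
  vehicle driven by a signal that is already known and continuous.\<close>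

lemma closed_loop_solution:
  fixes N :: nat
  assumes pos: "\<And>j. j \<in> {1..N} \<Longrightarrow> \<tau> j > 0 \<and> \<Lambda> j > 0 \<and> sym_pos_def (\<Gamma> j) \<and> wnorm P (x0 j - xr0 j) < c"
    and "\<tau>b > 0" "c > 0" "sym_pos_def P" "sym_pos_def Q"
    and "transpose (Am_mat h kp kd \<tau>b) ** P + P ** Am_mat h kp kd \<tau>b = - Q"
    and "continuous_on {0..} v0" "continuous_on {0..} u0"
  shows "\<exists>x xr k. closed_loop N h kp kd \<tau>b c P \<tau> \<Lambda> \<Gamma> v0 u0 {0..} x xr k \<and>
           (\<forall>j\<in>{1..N}. x j 0 = x0 j \<and> xr j 0 = xr0 j \<and> k j 0 = k0 j)"
  using pos
proof (induction N)
  case 0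
  then show ?case by (simp add: closed_loop_def)
next
  case (Suc N)
  obtain x xr k where cl: "closed_loop N h kp kd \<tau>b c P \<tau> \<Lambda> \<Gamma> v0 u0 {0..} x xr k"
    and init: "\<And>j. j \<in> {1..N} \<Longrightarrow> x j 0 = x0 j \<and> xr j 0 = xr0 j \<and> k j 0 = k0 j"
    using Suc.IH Suc.prems by fastforce
  define w where "w = w_prev v0 u0 x (Suc N)"
  have w: "continuous_on {0..} w"
  proof (cases "N = 0")
    case True
    then show ?thesis
      using assms by (simp add: w_def w_prev_def[abs_def] continuous_on_vector_2)
  next
    case False
    then have "continuous_on {0..} (x N)"
      using cl by (auto simp: closed_loop_def intro: ode_sol_imp_continuous_on)
    then show ?thesis
      using False by (simp add: w_def w_prev_def[abs_def]) (intro continuous_on_vector_2 continuous_intros)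
  qed
  obtain xS xrS kS where S:
    "ode_sol (\<lambda>t \<xi>. A_mat h kp kd (\<tau> (Suc N)) (\<Lambda> (Suc N)) *v \<xi> + Bw_mat h kd *v w t
        + (\<Lambda> (Suc N) / \<tau> (Suc N) * (kS t \<bullet> \<xi>)) *\<^sub>R Bu_vec) {0..} xS"
    "ode_sol (\<lambda>t \<xi>. Am_mat h kp kd \<tau>b *v \<xi> + Bw_mat h kd *v w t) {0..} xrS"
    "ode_sol (\<lambda>t \<kappa>. adapt_law c P (\<Gamma> (Suc N)) (xS t) (xS t - xrS t)) {0..} kS"
    "xS 0 = x0 (Suc N)" "xrS 0 = xr0 (Suc N)" "kS 0 = k0 (Suc N)"
    using vehicle_solution[of "\<tau> (Suc N)" "\<Lambda> (Suc N)" \<tau>b c "\<Gamma> (Suc N)" P Q h kp kd w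
        "x0 (Suc N)" "xr0 (Suc N)" "k0 (Suc N)"] Suc.prems[of "Suc N"] assms w by auto
  let ?x = "x(Suc N := xS)" and ?xr = "xr(Suc N := xrS)" and ?k = "k(Suc N := kS)"
  have "closed_loop N h kp kd \<tau>b c P \<tau> \<Lambda> \<Gamma> v0 u0 {0..} ?x ?xr ?k"
    by (rule closed_loop_cong[OF cl]) auto
  \<comment> \<open>The appended vehicle reads index \<open>N\<close> or the leader, neither of
    which the update at \<open>Suc N\<close> changes.\<close>
  moreover have "w_prev v0 u0 ?x (Suc N) = w"
    by (simp add: w_def fun_eq_iff w_prev_def)
  ultimately have "closed_loop (Suc N) h kp kd \<tau>b c P \<tau> \<Lambda> \<Gamma> v0 u0 {0..} ?x ?xr ?k"
    using S unfolding closed_loop_def atLeastAtMostSuc_conv[of 1 N, simplified] by simp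
  moreover have "\<forall>j\<in>{1..Suc N}. ?x j 0 = x0 j \<and> ?xr j 0 = xr0 j \<and> ?k j 0 = k0 j"
    using init S by (auto simp: le_Suc_eq)
  ultimately show ?case by blast
qed

text \<open>The first conjunct rules out vacuity: initial errors inside the barrier start a
  closed-loop trajectory on all of \<open>{0..}\<close>. The last one covers solutions on arbitrary
  intervals from 0, so the bound does not presuppose that they live forever.\<close>

theorem theorem2:
  fixes N :: nat and h kp kd \<tau>b c :: real
    and \<tau> \<Lambda> :: "nat \<Rightarrow> real"
    and \<Gamma> :: "nat \<Rightarrow> real^4^4" and Pm Qm :: "real^4^4"
    and v0 u0 :: "real \<Rightarrow> real"
  assumes "N \<ge> 1"
    and "h > 0" "kp > 0" "kd > 0" "\<tau>b > 0" "kd > \<tau>b * kp" "c > 0"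
    and "\<And>j. j \<in> {1..N} \<Longrightarrow> \<tau> j > 0 \<and> \<Lambda> j > 0"
    and "\<And>j. j \<in> {1..N} \<Longrightarrow> sym_pos_def (\<Gamma> j)"
    and "sym_pos_def Pm" "sym_pos_def Qm"
    and "transpose (Am_mat h kp kd \<tau>b) ** Pm + Pm ** Am_mat h kp kd \<tau>b = - Qm"
    and "continuous_on {0..} v0" "continuous_on {0..} u0"
  shows
    "(\<forall>x0 xr0 k0. (\<forall>j\<in>{1..N}. wnorm Pm (x0 j - xr0 j) < c) \<longrightarrow>
        (\<exists>x xr k. closed_loop N h kp kd \<tau>b c Pm \<tau> \<Lambda> \<Gamma> v0 u0 {0..} x xr k \<and>
           (\<forall>j\<in>{1..N}. x j 0 = x0 j \<and> xr j 0 = xr0 j \<and> k j 0 = k0 j))) \<and>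
     (\<forall>x xr k. closed_loop N h kp kd \<tau>b c Pm \<tau> \<Lambda> \<Gamma> v0 u0 {0..} x xr k \<and>
        (\<forall>j\<in>{1..N}. wnorm Pm (x j 0 - xr j 0) < c) \<longrightarrow>
        (\<forall>j\<in>{1..N}. lyapunov_stable_origin
           (error_dynamics h kp kd \<tau>b c Pm (\<tau> j) (\<Lambda> j) (\<Gamma> j) (xr j)))) \<and>
     (\<forall>I x xr k. forward_interval 0 I \<and>
        closed_loop N h kp kd \<tau>b c Pm \<tau> \<Lambda> \<Gamma> v0 u0 I x xr k \<and>
        (\<forall>j\<in>{1..N}. wnorm Pm (x j 0 - xr j 0) < c) \<longrightarrow>
        (\<forall>j\<in>{1..N}. \<forall>t\<in>I. wnorm Pm (x j t - xr j t) < c))"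
proof (intro conjI allI impI ballI)
  fix x0 xr0 k0 :: "nat \<Rightarrow> real^4"
  assume "\<forall>j\<in>{1..N}. wnorm Pm (x0 j - xr0 j) < c"
  then show "\<exists>x xr k. closed_loop N h kp kd \<tau>b c Pm \<tau> \<Lambda> \<Gamma> v0 u0 {0..} x xr k \<and>
           (\<forall>j\<in>{1..N}. x j 0 = x0 j \<and> xr j 0 = xr0 j \<and> k j 0 = k0 j)"
    using assms by (intro closed_loop_solution) auto
next
  fix x xr k j
  assume cl: "closed_loop N h kp kd \<tau>b c Pm \<tau> \<Lambda> \<Gamma> v0 u0 {0..} x xr k \<and>
        (\<forall>j\<in>{1..N}. wnorm Pm (x j 0 - xr j 0) < c)" and j: "j \<in> {1..N}"
  then have xr: "continuous_on {0..} (xr j)"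
    by (auto simp: closed_loop_def intro: ode_sol_imp_continuous_on)
  obtain H where sys: "adaptive_system (Am_mat h kp kd \<tau>b) Pm Qm (\<Gamma> j) H (\<Lambda> j / \<tau> j) c"
    and err: "error_dynamics h kp kd \<tau>b c Pm (\<tau> j) (\<Lambda> j) (\<Gamma> j) =
      adaptive_system.field (Am_mat h kp kd \<tau>b) Pm (\<Gamma> j) Bu_vec (\<Lambda> j / \<tau> j) (\<lambda>e. psi' c (wnorm Pm e))"
    using adaptive_system_vehicle assms j by metis
  show "lyapunov_stable_origin (error_dynamics h kp kd \<tau>b c Pm (\<tau> j) (\<Lambda> j) (\<Gamma> j) (xr j))"
    unfolding err by (rule adaptive_system.stable[OF sys xr])
next
  fix I x xr k j t
  assume cl: "forward_interval 0 I \<and> closed_loop N h kp kd \<tau>b c Pm \<tau> \<Lambda> \<Gamma> v0 u0 I x xr k \<and>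
        (\<forall>j\<in>{1..N}. wnorm Pm (x j 0 - xr j 0) < c)" and j: "j \<in> {1..N}" and t: "t \<in> I"
  obtain H where sys: "adaptive_system (Am_mat h kp kd \<tau>b) Pm Qm (\<Gamma> j) H (\<Lambda> j / \<tau> j) c"
    and err: "error_dynamics h kp kd \<tau>b c Pm (\<tau> j) (\<Lambda> j) (\<Gamma> j) =
      adaptive_system.field (Am_mat h kp kd \<tau>b) Pm (\<Gamma> j) Bu_vec (\<Lambda> j / \<tau> j) (\<lambda>e. psi' c (wnorm Pm e))"
    using adaptive_system_vehicle assms j by metis
  \<comment> \<open>By the matching condition, the tracking and gain errors of the platoon solve the
    abstract error system, to which barrier invariance applies.\<close>
  have "ode_sol (error_dynamics h kp kd \<tau>b c Pm (\<tau> j) (\<Lambda> j) (\<Gamma> j) (xr j)) I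
           (\<lambda>t. (x j t - xr j t, k j t - kx_vec \<tau>b (\<tau> j) (\<Lambda> j)))"
    using cl j assms by (intro closed_loop_error_dynamics) auto
  from adaptive_system.barrier_invariance(1)[OF sys _ this[unfolded err] _ t, of 0]
  show "wnorm Pm (x j t - xr j t) < c"
    using cl j by simp
qed

end
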